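(* Let $\mathcal{P}$ be a homogeneous Poisson process of intensity $1$ on $\mathbb{R}$ and let $\mu(\{2\})=1$ (every point has exactly two stubs). If for some $L>0$ we have $\mathbb{P}([0,L]\text{ is good})>0.968$, then the 2-stub stable multi-matching almost surely has an infinite component.
   Context: Stable multi-matching (2-stub case). Let $[\mathcal{P}]$ be the point-set of $\mathcal{P}$. The 2-stub stable multi-matching is the a.s. unique simple graph with vertex set $[\mathcal{P}]$ in which every vertex has degree exactly $2$ and such that, for any two distinct $x,y\in[\mathcal{P}]$, either they are linked by an edge or at least one of them has no incident edge longer than $|x-y|$ (the length of an edge $(x,y)$ being $|x-y|$). Its a.s. existence and uniqueness are known. A component is a connected component; it is infinite if it has infinitely many vertices. Core multi-matching. Let $S\subset\mathbb{R}^d$ be bounded, $P\subset S$ a finite set, and $(D_x)_{x\in P}$ positive integers. Let $S^C=\mathbb{R}^d\setminus S$ and $\widetilde P=P\cup\{S^C\}$, where $S^C$ is treated as one additional element, with the distance from $x$ to $S^C$ being the usual point-to-set distance. Assume that all distances between pairs of elements of $\widetilde P$ are distinct (this holds a.s. below). Assign $D_x$ stubs to each $x\in P$ and one stub to $S^C$. Repeat the following: from each $x\in P$ that currently has an unused stub, assign an arrow pointing to the closest other element of $\widetilde P$ among those that have at least one unused stub and do not already have an edge to $x$; then, for every pair $x,y\in P$ whose arrows point to each other, connect them by an edge and remove one stub from each; erase all arrows. (No edges are ever formed with $S^C$, which keeps its stub.) After finitely many iterations no more edges are added; the resulting graph on $P$ is the core multi-matching of $(P,D)$ in $S$. Good interval.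 For a bounded interval $I=[a,b]$, the core multi-matching on $I$ is the core multi-matching of $([\mathcal{P}]\cap I,D)$ in $I$ with $d=1$ and $D\equiv 2$. The interval $I=[a,b]$ is good if the core multi-matching on $I$ has a connected component with a point in the first quarter $[a,\tfrac34a+\tfrac14b]$ and a point in the last quarter $[\tfrac14a+\tfrac34b,b]$. *)

theory Defs
  imports "HOL-Probability.Probability"
begin

section \<open>Homogeneous Poisson processes\<close>

text \<open>
  A (simple) point process is a random locally finite set \<open>\<X> \<omega>\<close>, its point-set. The law of the
  counts is written out instead of using \<^const>\<open>poisson_pmf\<close>, which is only specified for a positive
  rate, whereas bounded Borel sets may be null sets.
\<close>

locale homogeneous_poisson_process = prob_space M
  for M :: "'w measure" and rate :: real and \<X> :: "'w \<Rightarrow> 'a::euclidean_space set" +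
  assumes locally_finite:
    "\<omega> \<in> space M \<Longrightarrow> bounded B \<Longrightarrow> finite (\<X> \<omega> \<inter> B)"
  and count_measurable:
    "bounded B \<Longrightarrow> B \<in> sets borel \<Longrightarrow>
       (\<lambda>\<omega>. card (\<X> \<omega> \<inter> B)) \<in> measurable M (count_space UNIV)"
  and count_poisson:
    "bounded B \<Longrightarrow> B \<in> sets borel \<Longrightarrow>
       prob {\<omega> \<in> space M. card (\<X> \<omega> \<inter> B) = k} =
         (rate * measure lborel B) ^ k / fact k * exp (- (rate * measure lborel B))"
  and count_indep:
    "(\<And>i. i < n \<Longrightarrow> bounded (A i) \<and> A i \<in> sets borel) \<Longrightarrow> disjoint_family_on A {..<n} \<Longrightarrow>
       indep_vars (\<lambda>_. count_space UNIV) (\<lambda>i \<omega>. card (\<X> \<omega> \<inter> A i)) {..<(n::nat)}"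


section \<open>Graphs\<close>

text \<open>A simple graph on a vertex set is given by its symmetric, irreflexive adjacency relation.\<close>

definition simple_graph :: "'a set \<Rightarrow> ('a \<times> 'a) set \<Rightarrow> bool" where
  "simple_graph V E \<longleftrightarrow> E \<subseteq> V \<times> V \<and> sym E \<and> irrefl E"

definition vertex_degree :: "('a \<times> 'a) set \<Rightarrow> 'a \<Rightarrow> nat" where
  "vertex_degree E x = card (E `` {x})"

definition graph_components :: "'a set \<Rightarrow> ('a \<times> 'a) set \<Rightarrow> 'a set set" where
  "graph_components V E = {{y \<in> V. (x, y) \<in> E\<^sup>*} | x. x \<in> V}"


section \<open>The 2-stub stable multi-matching\<close>

definition is_stable_multi_matching :: "'a::metric_space set \<Rightarrow> ('a \<times> 'a) set \<Rightarrow> bool" where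
  "is_stable_multi_matching V E \<longleftrightarrow>
     simple_graph V E \<and>
     (\<forall>x\<in>V. vertex_degree E x = 2) \<and>
     (\<forall>x\<in>V. \<forall>y\<in>V. x \<noteq> y \<longrightarrow>
        (x, y) \<in> E \<or>
        (\<forall>z. (x, z) \<in> E \<longrightarrow> dist x z \<le> dist x y) \<or>
        (\<forall>z. (y, z) \<in> E \<longrightarrow> dist y z \<le> dist x y))"

text \<open>
  For almost every realisation of a Poisson process exactly one such graph exists, so that the
  description is proper; elsewhere its value is unspecified.
\<close>

definition stable_multi_matching :: "'a::metric_space set \<Rightarrow> ('a \<times> 'a) set" where
  "stable_multi_matching V = (THE E. is_stable_multi_matching V E)"


section \<open>The core multi-matching\<close>

text \<open>
  The elements of \<open>P \<union> {S\<^sup>C}\<close> are encoded as \<open>Some y\<close> for \<open>y \<in> P\<close> and \<open>None\<close> for the complement of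
  \<open>S\<close>.
\<close>

fun core_dist :: "'a::euclidean_space set \<Rightarrow> 'a \<Rightarrow> 'a option \<Rightarrow> real" where
  "core_dist S x (Some y) = dist x y"
| "core_dist S x None = infdist x (- S)"

text \<open>
  One stub is removed per edge, so the unused stubs of \<open>x\<close> number \<open>D x\<close> minus its current degree.
\<close>

definition has_unused_stub :: "('a \<Rightarrow> nat) \<Rightarrow> ('a \<times> 'a) set \<Rightarrow> 'a \<Rightarrow> bool" where
  "has_unused_stub D E x \<longleftrightarrow> vertex_degree E x < D x"

definition core_candidates ::
    "'a set \<Rightarrow> ('a \<Rightarrow> nat) \<Rightarrow> ('a \<times> 'a) set \<Rightarrow> 'a \<Rightarrow> 'a option set" where
  "core_candidates P D E x =
     insert None (Some ` {y \<in> P. y \<noteq> x \<and> has_unused_stub D E y \<and> (x, y) \<notin> E})"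

text \<open>
  The strict inequality makes the arrow of \<open>x\<close> unique. It only matters when two distances coincide,
  a case excluded by the standing assumption that all distances are distinct.
\<close>

definition core_arrow ::
    "'a::euclidean_space set \<Rightarrow> 'a set \<Rightarrow> ('a \<Rightarrow> nat) \<Rightarrow> ('a \<times> 'a) set \<Rightarrow> 'a \<Rightarrow> 'a option \<Rightarrow> bool"
  where
  "core_arrow S P D E x t \<longleftrightarrow>
     x \<in> P \<and> has_unused_stub D E x \<and> t \<in> core_candidates P D E x \<and>
     (\<forall>u \<in> core_candidates P D E x - {t}. core_dist S x t < core_dist S x u)"

definition core_step ::
    "'a::euclidean_space set \<Rightarrow> 'a set \<Rightarrow> ('a \<Rightarrow> nat) \<Rightarrow> ('a \<times> 'a) set \<Rightarrow> ('a \<times> 'a) set" where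
  "core_step S P D E =
     E \<union> {(x, y). core_arrow S P D E x (Some y) \<and> core_arrow S P D E y (Some x)}"

text \<open>The edge sets increase and, for finite \<open>P\<close>, become stationary: their union is the final graph.\<close>

definition core_multi_matching ::
    "'a::euclidean_space set \<Rightarrow> 'a set \<Rightarrow> ('a \<Rightarrow> nat) \<Rightarrow> ('a \<times> 'a) set" where
  "core_multi_matching S P D = (\<Union>n. (core_step S P D ^^ n) {})"


section \<open>Good intervals\<close>

definition good_interval :: "real set \<Rightarrow> real \<Rightarrow> real \<Rightarrow> bool" where
  "good_interval V a b \<longleftrightarrow>
     (\<exists>C \<in> graph_components (V \<inter> {a..b}) (core_multi_matching {a..b} (V \<inter> {a..b}) (\<lambda>_. 2)).
        C \<inter> {a..3/4 * a + 1/4 * b} \<noteq> {} \<and> C \<inter> {1/4 * a + 3/4 * b..b} \<noteq> {})"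

end

theory Submission
  imports Defs
begin

text \<open>
  Call an interval bad if it is not good. The heart of the matter is a renormalisation inequality: if
  \<open>q l\<close> is the probability that an interval of length \<open>l\<close> is bad, then \<open>q (7 * l) \<le> 11 * (q l)\<^sup>2\<close>.
  Since \<open>11 * 0.032 < 1\<close>, the hypothesis makes \<open>q (7 ^ n * L)\<close> decay so fast that its sum is finite, and
  by Borel--Cantelli almost surely all intervals from a fixed finite list at each large scale
  \<open>7 ^ n * L\<close> are good. Overlapping good intervals, chosen so that they link each scale to the next one,
  then carry a single unbounded component (\<open>infinite_component_if_good_scales\<close>).

  The inequality is deterministic up to one use of independence. Cut an interval of length \<open>7 * l\<close> into
  13 half-overlapping intervals of length \<open>l\<close>. The long interval is good unless, for one of 11
  indices \<open>k\<close>, the \<open>k\<close>-th and the \<open>(k + 2)\<close>-nd short ones are both bad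
  (\<open>good_interval_renormalise\<close>), and these two have disjoint interiors.

  Two features of distance-greedy graphs on the line are responsible. First, two vertices that each
  have an edge longer than their distance are linked. Hence crossing edges lie in one component, and the
  crossing components of overlapping good intervals coincide (\<open>crossings_meet\<close>). Secondly, a gap left
  by one or two adjacent bad intervals is closed nevertheless (\<open>gap_is_bridged\<close>): a component which is
  wider than its longest edge is not a cycle that could have turned back, but ends with a free stub
  exactly at its rightmost point (\<open>right_end_open\<close>). So a free stub on each side
  faces the gap. The two stubs are closer to each other than to the boundary or to any other stub
  behind them, and the greedy construction links them, possibly through points inside the gap.

  Edges of a core multi-matching survive in the core of every larger interval and in every stable
  multi-matching of the line (\<open>core_subset\<close>). The cores of growing good intervals
  therefore converge to a stable multi-matching, which is unique because an inner
  point of a good interval uses both of its stubs (\<open>stable_multi_matching_exists_unique\<close>).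

  Goodness of an interval is a property of the random point-set and has to be related to the
  counts by which the Poisson process is described. When no two relevant distances
  coincide, goodness depends only on the order of finitely many distances, so it is unchanged when each
  point is moved to the left end of its cell in a fine dyadic grid
  (\<open>good_interval_grid_approximation\<close>). It is thus almost surely a limit of events about
  which cells are occupied; translation invariance and independence pass to the limit.
\<close>

section \<open>Graphs built from the shortest pairs upwards\<close>

lemma rtrancl_exit:
  assumes "(p, q) \<in> F\<^sup>*" "P p" "\<not> P q"
  obtains u v where "(p, u) \<in> F\<^sup>*" "(u, v) \<in> F" "P u" "\<not> P v"
proof -
  have "\<exists>u v. (p, u) \<in> F\<^sup>* \<and> (u, v) \<in> F \<and> P u \<and> \<not> P v"
    using assms(1-3) by (induction rule: rtrancl_induct) blast+
  then show thesis using that by blast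
qed

text \<open>
  Swapping the components pairs off the elements below and above the diagonal.
\<close>

lemma even_card_symmetric:
  fixes R :: "('a::linorder \<times> 'a) set"
  assumes "finite R" "sym R" "irrefl R"
  shows "even (card R)"
proof -
  let ?U = "{e \<in> R. fst e < snd e}" and ?D = "{e \<in> R. snd e < fst e}"
  have "R \<subseteq> ?U \<union> ?D"
  proof
    fix e assume e: "e \<in> R"
    then have "fst e \<noteq> snd e" using assms(3) by (cases e) (auto simp: irrefl_def)
    then show "e \<in> ?U \<union> ?D" using e by auto
  qed
  then have R: "R = ?U \<union> ?D" by blast
  have "bij_betw prod.swap ?U ?D"
  proof (rule bij_betw_byWitness[of _ prod.swap])
    have "prod.swap e \<in> R" if "e \<in> R" for e
      using that by (cases e) (auto intro: symD[OF assms(2)])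
    then show "prod.swap ` ?U \<subseteq> ?D" "prod.swap ` ?D \<subseteq> ?U" by auto
  qed auto
  then have "card ?U = card ?D" by (rule bij_betw_same_card)
  moreover have "card (?U \<union> ?D) = card ?U + card ?D"
    using assms(1) by (intro card_Un_disjoint) auto
  ultimately have "card R = 2 * card ?U" using R by simp
  then show ?thesis by simp
qed

text \<open>
  The last assumption is the trace left by joining pairs in the order of increasing length: when \<open>x\<close> was
  joined to \<open>z\<close> instead of the closer vertex \<open>y\<close>, the stubs of \<open>y\<close> must already have been used by edges
  no longer than \<open>dist x y\<close>.
  It is the common property of cores, of stable multi-matchings and of
  their restrictions to short edges; free stubs are allowed.
\<close>

locale greedy_graph =
  fixes V :: "'a::metric_space set" and E :: "('a \<times> 'a) set"
  assumes graph: "simple_graph V E"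
    and finite_nbrs: "finite (E `` {x})"
    and degree_le: "vertex_degree E x \<le> 2"
    and longer_edge: "y \<in> V \<Longrightarrow> x \<noteq> y \<Longrightarrow> (x, y) \<notin> E \<Longrightarrow> (x, z) \<in> E \<Longrightarrow> dist x y < dist x z \<Longrightarrow>
      vertex_degree E y = 2 \<and> (\<forall>w. (y, w) \<in> E \<longrightarrow> dist y w \<le> dist x y)"
begin

lemma edge_in: "(x, y) \<in> E \<Longrightarrow> x \<in> V" "(x, y) \<in> E \<Longrightarrow> y \<in> V"
  and edge_sym: "(x, y) \<in> E \<Longrightarrow> (y, x) \<in> E"
  and edge_neq: "(x, y) \<in> E \<Longrightarrow> x \<noteq> y"
  using graph by (auto simp: simple_graph_def irrefl_def dest: symD)

lemma connected_sym: "(x, y) \<in> E\<^sup>* \<Longrightarrow> (y, x) \<in> E\<^sup>*"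
  using graph unfolding simple_graph_def by (meson symD sym_rtrancl)

lemma connected_in: "(x, y) \<in> E\<^sup>* \<Longrightarrow> x \<in> V \<Longrightarrow> y \<in> V"
  by (induction rule: rtrancl_induct) (auto dest: edge_in)

lemma only_two_nbrs:
  assumes "(x, a) \<in> E" "(x, b) \<in> E" "a \<noteq> b" "(x, z) \<in> E"
  shows "z = a \<or> z = b"
proof (rule ccontr)
  assume "\<not> ?thesis"
  then have "card {a, b, z} = 3" using assms(3) by auto
  moreover have "card {a, b, z} \<le> card (E `` {x})"
    using assms by (intro card_mono finite_nbrs) auto
  ultimately show False using degree_le[of x] by (simp add: vertex_degree_def)
qed

lemma two_nbrs_degree:
  assumes "(x, a) \<in> E" "(x, b) \<in> E" "a \<noteq> b"
  shows "vertex_degree E x = 2"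
proof -
  have "card {a, b} \<le> card (E `` {x})"
    using assms by (intro card_mono finite_nbrs) auto
  then show ?thesis using assms(3) degree_le[of x] by (simp add: vertex_degree_def)
qed

text \<open>
  Otherwise each of the two vertices would have preferred the other one to the far end of its long edge.
\<close>

lemma linked_if_longer_edges:
  assumes "(a, b) \<in> E" "(y, z) \<in> E" "a \<noteq> y" "dist a y < dist a b" "dist a y < dist y z"
  shows "(a, y) \<in> E"
  using longer_edge[OF edge_in(1)[OF assms(2)] assms(3) _ assms(1,4)] assms(2,5) by fastforce

end

section \<open>Greedy graphs on the line\<close>

lemma in_uminus_image: "z \<in> uminus ` A \<longleftrightarrow> - z \<in> A" for z :: real
  by (metis (no_types, lifting) image_iff minus_minus)

lemma in_reflection: "(x, y) \<in> map_prod uminus uminus ` E \<longleftrightarrow> (- x, - y) \<in> E" for x y :: real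
proof
  assume "(- x, - y) \<in> E"
  then have "map_prod uminus uminus (- x, - y) \<in> map_prod uminus uminus ` E" by (rule imageI)
  then show "(x, y) \<in> map_prod uminus uminus ` E" by simp
qed auto

locale greedy_line = greedy_graph V E for V :: "real set" and E
begin

text \<open>
  Both endpoints of an edge over a vertex with a free stub would prefer that vertex, so both are
  linked to it and its stubs are used up.
\<close>

lemma open_vertex_not_covered:
  assumes "(a, b) \<in> E" "a < y" "y < b" "y \<in> V"
  shows "vertex_degree E y = 2"
proof (rule ccontr)
  assume deg: "vertex_degree E y \<noteq> 2"
  have "(a, y) \<in> E"
    using longer_edge[OF assms(4) _ _ assms(1)] assms deg by (auto simp: dist_real_def)
  moreover have "(b, y) \<in> E"
    using longer_edge[OF assms(4) _ _ edge_sym[OF assms(1)]] assms deg by (auto simp: dist_real_def)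
  ultimately show False
    using two_nbrs_degree[of y a b] edge_sym assms deg by auto
qed

text \<open>
  A path from \<open>p\<close> to \<open>q\<close> can pass an unsaturated vertex \<open>y\<close> only through \<open>y\<close> itself, because no edge
  covers \<open>y\<close>; but then \<open>y\<close> has neighbours on both sides.
\<close>

lemma between_connected_saturated:
  assumes "(p, q) \<in> E\<^sup>*" "p < y" "y < q" "y \<in> V"
  shows "vertex_degree E y = 2"
proof (rule ccontr)
  assume deg: "vertex_degree E y \<noteq> 2"
  obtain u v where uv: "(u, v) \<in> E" "u < y" "\<not> v < y"
    by (rule rtrancl_exit[OF assms(1), of "\<lambda>z. z < y"]) (use assms in auto)
  have "v = y" using open_vertex_not_covered[OF uv(1,2) _ assms(4)] uv(3) deg by force
  obtain u' v' where uv': "(u', v') \<in> E" "u' \<le> y" "\<not> v' \<le> y"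
    by (rule rtrancl_exit[OF assms(1), of "\<lambda>z. z \<le> y"]) (use assms in auto)
  have "u' = y" using open_vertex_not_covered[OF uv'(1) _ _ assms(4)] uv'(2,3) deg by force
  show False
    using two_nbrs_degree[of y u v'] uv uv' \<open>v = y\<close> \<open>u' = y\<close> edge_sym deg by auto
qed

text \<open>
  The path has to jump over \<open>b\<close>. An edge leaving the jumped interval would cross the jumping edge and,
  by \<open>linked_if_longer_edges\<close>, merge the two components.
\<close>

lemma component_enclosed:
  assumes "F \<subseteq> E" "(p, q) \<in> F\<^sup>*" "p < b" "b < q" "(p, b) \<notin> E\<^sup>*"
  obtains u v where "(u, v) \<in> F" "\<And>z. (b, z) \<in> E\<^sup>* \<Longrightarrow> u < z \<and> z < v"
proof -
  obtain u v where uv: "(p, u) \<in> F\<^sup>*" "(u, v) \<in> F" "u < b" "\<not> v < b"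
    by (rule rtrancl_exit[OF assms(2), of "\<lambda>z. z < b"]) (use assms in auto)
  have pu: "(p, u) \<in> E\<^sup>*" using uv(1) assms(1) rtrancl_mono by blast
  have E: "(u, v) \<in> E" using uv(2) assms(1) by blast
  have pv: "(p, v) \<in> E\<^sup>*" using pu E by simp
  have bv: "b < v" using pv assms(5) uv(4) by (cases "v = b") auto
  have "u < z \<and> z < v" if "(b, z) \<in> E\<^sup>*" for z
    using that
  proof (induction rule: rtrancl_induct)
    case base
    show ?case using uv bv by simp
  next
    case (step y z)
    have bz: "(b, z) \<in> E\<^sup>*" using step by simp
    have no: "(p, y) \<notin> E\<^sup>*" "(p, z) \<notin> E\<^sup>*"
      using assms(5) connected_sym step(1) bz by (meson rtrancl_trans)+
    then have "z \<noteq> u" "z \<noteq> v" using pu pv by auto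
    have yz: "(y, z) \<in> E" by (rule step(2))
    have "\<not> z < u"
    proof
      assume "z < u"
      then have "(u, y) \<in> E"
        using linked_if_longer_edges[OF E yz] step(3) by (auto simp: dist_real_def)
      then show False using no pu by (meson rtrancl.rtrancl_into_rtrancl)
    qed
    moreover have "\<not> v < z"
    proof
      assume "v < z"
      then have "(v, y) \<in> E"
        using linked_if_longer_edges[OF edge_sym[OF E] yz] step(3) by (auto simp: dist_real_def)
      then show False using no pv by (meson rtrancl.rtrancl_into_rtrancl)
    qed
    ultimately show ?case using \<open>z \<noteq> u\<close> \<open>z \<noteq> v\<close> by simp
  qed
  then show thesis using that uv(2) by blast
qed

text \<open>
  Let \<open>u\<close> be the farther neighbour of the rightmost vertex \<open>h\<close>, if \<open>h\<close> has two. The edge \<open>(h, u)\<close> shields the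
  vertices between: only a neighbour of \<open>u\<close> can have an edge to the left of \<open>u\<close>. The width of the component
  excludes that it lies inside \<open>[u, h]\<close>. So the vertices to the right of \<open>u\<close>, without that neighbour of \<open>u\<close> if it
  exists, form a set \<open>Q\<close> whose only edge to the outside is \<open>(h, u)\<close>. All vertices of \<open>Q\<close> are
  saturated, so the sum of their degrees is even, but it counts the inner edges twice and \<open>(h, u)\<close> once.
\<close>

lemma right_end_open:
  assumes fin: "finite (E\<^sup>* `` {p})"
    and short: "\<And>x y. (x, y) \<in> E \<Longrightarrow> dist x y < \<rho>"
    and wide: "h - p \<ge> \<rho>"
    and h: "(p, h) \<in> E\<^sup>*" "\<And>z. (p, z) \<in> E\<^sup>* \<Longrightarrow> z \<le> h"
  shows "vertex_degree E h \<noteq> 2"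
proof
  assume deg: "vertex_degree E h = 2"
  define C where "C = E\<^sup>* `` {p}"
  have finC: "finite C" and hC: "h \<in> C" and pC: "p \<in> C"
    using fin h by (auto simp: C_def)
  have step: "z \<in> C" if "(w, z) \<in> E" "w \<in> C" for w z
    using that by (auto simp: C_def intro: rtrancl_into_rtrancl)
  have le_h: "z \<le> h" if "z \<in> C" for z using that h by (auto simp: C_def)
  obtain s t where "E `` {h} = {s, t}" "s \<noteq> t"
    using deg by (auto simp: vertex_degree_def card_2_iff)
  then obtain u v where Eh: "E `` {h} = {u, v}" "u < v"
    by (metis insert_commute linorder_neqE_linordered_idom)
  then have hu: "(h, u) \<in> E" and hv: "(h, v) \<in> E" by auto
  have uC: "u \<in> C" and vC: "v \<in> C" using step hu hv hC by auto
  have vh: "v < h" using le_h[OF vC] edge_neq[OF hv] by simp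
  have uh: "u < h" using vh Eh by simp
  have pu: "p < u" using short[OF hu] wide uh by (simp add: dist_real_def)
  have ph: "p < h" using pu uh by simp
  have inward: "(u, w) \<in> E" if "(w, t) \<in> E" "u < w" "w < h" "t < u" for w t
    using linked_if_longer_edges[OF edge_sym[OF hu] that(1)] that by (auto simp: dist_real_def)
  \<comment> \<open>a neighbour of \<open>u\<close> below the edge \<open>(h, u)\<close> has its other edge to the left, since otherwise no edge leaves \<open>[u, h]\<close>, which is narrower than the component\<close>
  have star: "w \<le> u" if z: "u < z" "z < h" "(z, u) \<in> E" and w: "(z, w) \<in> E" for z w
  proof (rule ccontr)
    assume uw: "\<not> w \<le> u"
    have "u \<le> y" if "(h, y) \<in> E\<^sup>*" for y
      using that
    proof (induction rule: rtrancl_induct)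
      case base
      show ?case using uh by simp
    next
      case (step y t)
      have yC: "y \<in> C" using hC step(1) by (auto simp: C_def)
      consider "y = u" | "y = h" | "y = z" | "u < y" "y < h" "y \<noteq> z"
        using step(3) le_h[OF yC] by force
      then show ?case
      proof cases
        case 1
        then have "t = h \<or> t = z"
          using only_two_nbrs[of u h z t] edge_sym hu z step(2) by auto
        then show ?thesis using z uh by auto
      next
        case 2
        then show ?thesis using Eh step(2) by auto
      next
        case 3
        then have "t = u \<or> t = w" using only_two_nbrs[of z u w t] z w uw step(2) by auto
        then show ?thesis using uw by auto
      next
        case 4
        show ?thesis
        proof (rule ccontr)
          assume "\<not> u \<le> t"
          then have "(u, y) \<in> E" using inward[of y t] step(2) 4 by auto
          then show False using only_two_nbrs[of u h z y] edge_sym hu z 4 by auto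
        qed
      qed
    qed
    moreover have "(h, p) \<in> E\<^sup>*" using h(1) connected_sym by blast
    ultimately show False using pu by force
  qed
  define Q where "Q = insert h {w \<in> C. u < w \<and> (w, u) \<notin> E}"
  have finQ: "finite Q" using finC by (simp add: Q_def)
  have QC: "w \<in> C \<and> u < w" if "w \<in> Q" for w using that hC uh by (auto simp: Q_def)
  have degQ: "vertex_degree E w = 2" if "w \<in> Q" for w
  proof (cases "w = h")
    case False
    then have "p < w" "w < h" using QC[OF that] le_h pu by force+
    moreover have "w \<in> V"
      using QC[OF that] connected_in[of p w] edge_in(1)[of h u] hu connected_in connected_sym h(1)
      by (metis C_def Image_singleton_iff)
    ultimately show ?thesis using between_connected_saturated[OF h(1)] by simp
  qed (use deg in simp)
  have exits: "w = h \<and> z = u" if e: "(w, z) \<in> E" "w \<in> Q" "z \<notin> Q" for w z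
  proof -
    have zC: "z \<in> C" using step e QC by blast
    have zh: "z < h" using le_h[OF zC] e(3) by (auto simp: Q_def)
    have zu: "z \<le> u"
    proof (rule ccontr)
      assume "\<not> z \<le> u"
      then have "u < z" "(z, u) \<in> E" using e(3) zC by (auto simp: Q_def)
      then show False using star[of z w] zh edge_sym[OF e(1)] QC[OF e(2)] by force
    qed
    have "w = h"
    proof (rule ccontr)
      assume "w \<noteq> h"
      then have w: "u < w" "w < h" "(w, u) \<notin> E" using e(2) QC[OF e(2)] le_h by (force simp: Q_def)+
      then have "z \<noteq> u" using e(1) by auto
      then show False using inward[OF e(1) w(1,2)] zu w(3) edge_sym by force
    qed
    moreover have "z = u" using \<open>w = h\<close> Eh e(1) zu by auto
    ultimately show ?thesis by simp
  qed
  have uQ: "u \<notin> Q" using uh by (auto simp: Q_def)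
  \<comment> \<open>count the edges at \<open>Q\<close> with their orientation in two ways\<close>
  have "(SIGMA w:Q. E `` {w}) = (E \<inter> Q \<times> Q) \<union> {(h, u)}"
    using exits hu by (auto simp: Q_def)
  moreover have "(E \<inter> Q \<times> Q) \<inter> {(h, u)} = {}" using uQ by auto
  moreover have "finite (E \<inter> Q \<times> Q)" using finQ by simp
  ultimately have "card (SIGMA w:Q. E `` {w}) = card (E \<inter> Q \<times> Q) + 1"
    by (simp add: card_Un_disjoint)
  moreover have "card (SIGMA w:Q. E `` {w}) = 2 * card Q"
    using finQ finite_nbrs degQ by (simp add: vertex_degree_def)
  moreover have "even (card (E \<inter> Q \<times> Q))"
    using finQ edge_sym edge_neq by (intro even_card_symmetric) (auto intro!: symI simp: irrefl_def)
  ultimately show False by (metis even_Suc dvd_triv_left Suc_eq_plus1)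
qed

text \<open>
  Reflecting the line turns statements about right ends into statements about left ends.
\<close>

lemma reflect: "greedy_line (uminus ` V) (map_prod uminus uminus ` E)"
proof -
  let ?E = "map_prod uminus uminus ` E"
  have iff: "(x, y) \<in> ?E \<longleftrightarrow> (- x, - y) \<in> E" for x y
    by (rule in_reflection)
  have img: "?E `` {x} = uminus ` (E `` {- x})" for x
    by (intro set_eqI) (simp add: iff in_uminus_image)
  have deg: "vertex_degree ?E x = vertex_degree E (- x)" for x
    unfolding vertex_degree_def img by (simp add: card_image)
  show ?thesis
  proof
    show "simple_graph (uminus ` V) ?E"
    proof -
      have "?E \<subseteq> uminus ` V \<times> uminus ` V" using edge_in by auto
      moreover have "sym ?E" using edge_sym by (intro symI) (simp add: iff)
      moreover have "irrefl ?E" using edge_neq by (intro irreflI) (auto simp: iff)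
      ultimately show ?thesis by (simp add: simple_graph_def)
    qed
    show "finite (?E `` {x})" for x unfolding img using finite_nbrs by simp
    show "vertex_degree ?E x \<le> 2" for x unfolding deg by (rule degree_le)
    fix x y z
    assume a: "y \<in> uminus ` V" "x \<noteq> y" "(x, y) \<notin> ?E" "(x, z) \<in> ?E" "dist x y < dist x z"
    have "vertex_degree E (- y) = 2 \<and> (\<forall>w. (- y, w) \<in> E \<longrightarrow> dist (- y) w \<le> dist (- x) (- y))"
      by (rule longer_edge[of "- y" "- x" "- z"]) (use a in \<open>auto simp: iff dist_real_def\<close>)
    moreover have "dist y w = dist (- y) (- w)" "dist (- x) (- y) = dist x y" for w
      by (simp_all add: dist_real_def)
    ultimately show "vertex_degree ?E y = 2 \<and> (\<forall>w. (y, w) \<in> ?E \<longrightarrow> dist y w \<le> dist x y)"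
      unfolding deg iff by metis
  qed
qed

lemma left_end_open:
  assumes fin: "finite (E\<^sup>* `` {p})"
    and short: "\<And>x y. (x, y) \<in> E \<Longrightarrow> dist x y < \<rho>"
    and wide: "p - h \<ge> \<rho>"
    and h: "(p, h) \<in> E\<^sup>*" "\<And>z. (p, z) \<in> E\<^sup>* \<Longrightarrow> h \<le> z"
  shows "vertex_degree E h \<noteq> 2"
proof -
  let ?E = "map_prod uminus uminus ` E"
  have iff: "(x, y) \<in> ?E \<longleftrightarrow> (- x, - y) \<in> E" for x y
    by (rule in_reflection)
  have iffs: "(x, y) \<in> ?E\<^sup>* \<longleftrightarrow> (- x, - y) \<in> E\<^sup>*" for x y
  proof
    show "(- x, - y) \<in> E\<^sup>*" if "(x, y) \<in> ?E\<^sup>*"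
      using that by (induction rule: rtrancl_induct) (auto simp: iff intro: rtrancl_into_rtrancl)
    have "(x, - z) \<in> ?E\<^sup>*" if "(- x, z) \<in> E\<^sup>*" for z
      using that
    proof (induction rule: rtrancl_induct)
      case (step y z)
      have "(- y, - z) \<in> ?E" using step(2) by (simp add: iff)
      then show ?case using step(3) by (rule rtrancl_into_rtrancl[rotated])
    qed simp
    then show "(x, y) \<in> ?E\<^sup>*" if "(- x, - y) \<in> E\<^sup>*" using that by fastforce
  qed
  have img: "?E `` {x} = uminus ` (E `` {- x})" for x
    by (intro set_eqI) (simp add: iff in_uminus_image)
  have imgs: "?E\<^sup>* `` {x} = uminus ` (E\<^sup>* `` {- x})" for x
    by (intro set_eqI) (simp add: iffs in_uminus_image)
  interpret R: greedy_line "uminus ` V" ?E by (rule reflect)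
  have "vertex_degree ?E (- h) \<noteq> 2"
  proof (rule R.right_end_open[of "- p" \<rho>])
    show "finite (?E\<^sup>* `` {- p})" unfolding imgs using fin by simp
    show "dist x y < \<rho>" if "(x, y) \<in> ?E" for x y
      using short[of "- x" "- y"] that by (simp add: iff dist_real_def)
    show "z \<le> - h" if "(- p, z) \<in> ?E\<^sup>*" for z
      using h(2)[of "- z"] that by (simp add: iffs)
  qed (use wide h in \<open>auto simp: iffs\<close>)
  then show ?thesis unfolding vertex_degree_def img by (simp add: card_image)
qed

end

section \<open>The core multi-matching as a greedy graph\<close>

abbreviation core :: "'a::euclidean_space set \<Rightarrow> 'a set \<Rightarrow> ('a \<times> 'a) set" where
  "core S P \<equiv> core_multi_matching S P (\<lambda>_. 2)"

abbreviation stage :: "'a::euclidean_space set \<Rightarrow> 'a set \<Rightarrow> nat \<Rightarrow> ('a \<times> 'a) set" where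
  "stage S P n \<equiv> (core_step S P (\<lambda>_. 2) ^^ n) {}"

abbreviation arrow ::
    "'a::euclidean_space set \<Rightarrow> 'a set \<Rightarrow> ('a \<times> 'a) set \<Rightarrow> 'a \<Rightarrow> 'a \<Rightarrow> bool" where
  "arrow S P E x y \<equiv> core_arrow S P (\<lambda>_. 2) E x (Some y)"

text \<open>
  Only distances measured from the same point are ever compared by the core algorithm, so only those
  need to differ. \<open>None\<close> stands for the complement of \<open>S\<close>.
\<close>

definition no_ties :: "'a::euclidean_space set \<Rightarrow> 'a set \<Rightarrow> bool" where
  "no_ties S P \<longleftrightarrow> (\<forall>x\<in>P. inj_on (core_dist S x) (insert None (Some ` (P - {x}))))"

text \<open>
  A pair of unlinked vertices with free stubs, closer to each other than \<open>r\<close> allows, is never a pair of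
  mutually nearest candidates. With \<open>r\<close> the distance to the boundary this is what termination of the core
  algorithm gives. It is weaker than saying that no such pair exists: both vertices may be
  waiting for closer ones which in turn point to the boundary.
\<close>

definition open_pairs_improvable :: "('a \<Rightarrow> real) \<Rightarrow> 'a::metric_space set \<Rightarrow> ('a \<times> 'a) set \<Rightarrow> bool" where
  "open_pairs_improvable r V E \<longleftrightarrow>
     (\<forall>x\<in>V. \<forall>y\<in>V. x \<noteq> y \<longrightarrow> (x, y) \<notin> E \<longrightarrow> vertex_degree E x < 2 \<longrightarrow> vertex_degree E y < 2 \<longrightarrow>
        dist x y < r x \<longrightarrow> dist x y < r y \<longrightarrow>
        (\<exists>u\<in>V. vertex_degree E u < 2 \<and>
           (u \<noteq> x \<and> (x, u) \<notin> E \<and> dist x u < dist x y \<or>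
            u \<noteq> y \<and> (y, u) \<notin> E \<and> dist y u < dist x y)))"

lemma arrow_iff:
  "arrow S P E x y \<longleftrightarrow>
     x \<in> P \<and> y \<in> P \<and> x \<noteq> y \<and> (x, y) \<notin> E \<and> vertex_degree E x < 2 \<and> vertex_degree E y < 2 \<and>
     dist x y < infdist x (- S) \<and>
     (\<forall>u\<in>P. u \<noteq> x \<longrightarrow> vertex_degree E u < 2 \<longrightarrow> (x, u) \<notin> E \<longrightarrow> u \<noteq> y \<longrightarrow> dist x y < dist x u)"
proof -
  let ?K = "core_candidates P (\<lambda>_. 2) E x"
  have "(\<forall>t\<in>?K - {Some y}. dist x y < core_dist S x t) \<longleftrightarrow>
      (\<forall>t\<in>insert None (Some ` {u. Some u \<in> ?K \<and> u \<noteq> y}). dist x y < core_dist S x t)"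
    by (rule ball_cong) (auto simp: core_candidates_def)
  then show ?thesis
    by (auto simp: core_arrow_def core_candidates_def has_unused_stub_def)
qed

lemma arrowD:
  assumes "arrow S P E x y"
  shows "x \<in> P" "y \<in> P" "x \<noteq> y" "(x, y) \<notin> E" "vertex_degree E x < 2" "vertex_degree E y < 2"
    and "dist x y < infdist x (- S)"
    and "\<And>u. u \<in> P \<Longrightarrow> u \<noteq> x \<Longrightarrow> vertex_degree E u < 2 \<Longrightarrow> (x, u) \<notin> E \<Longrightarrow> u \<noteq> y \<Longrightarrow> dist x y < dist x u"
  using assms unfolding arrow_iff by blast+

lemma arrow_unique:
  assumes "arrow S P E x y" "arrow S P E x z"
  shows "y = z"
  using arrowD[OF assms(1)] arrowD[OF assms(2)] by (metis order_less_asym)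

lemma stage_Suc:
  "stage S P (Suc n) = stage S P n \<union> {(x, y). arrow S P (stage S P n) x y \<and> arrow S P (stage S P n) y x}"
  by (simp add: core_step_def)

lemma stage_mono: "m \<le> n \<Longrightarrow> stage S P m \<subseteq> stage S P n"
  by (rule lift_Suc_mono_le[of "stage S P"]) (auto simp: core_step_def)

lemma stage_subset_core: "stage S P n \<subseteq> core S P"
  by (auto simp: core_multi_matching_def)

lemma stage_graph:
  "simple_graph P (stage S P n)" "finite (stage S P n `` {x})" "vertex_degree (stage S P n) x \<le> 2"
proof (induction n arbitrary: x)
  case 0
  { case 1 show ?case by (simp add: simple_graph_def sym_def irrefl_def) }
  { case 2 show ?case by simp }
  { case 3 show ?case by (simp add: vertex_degree_def) }
next
  case (Suc n)
  let ?E = "stage S P n"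
  have nbrs: "stage S P (Suc n) `` {x} \<subseteq> ?E `` {x} \<union> {y. arrow S P ?E x y}" for x
    unfolding stage_Suc by auto
  have new: "stage S P (Suc n) `` {x} = ?E `` {x} \<or>
      (\<exists>y. vertex_degree ?E x < 2 \<and> stage S P (Suc n) `` {x} \<subseteq> insert y (?E `` {x}))" for x
  proof (cases "\<exists>y. arrow S P ?E x y")
    case True
    then obtain y where y: "arrow S P ?E x y" by blast
    then have "{y. arrow S P ?E x y} \<subseteq> {y}" using arrow_unique by blast
    then show ?thesis using nbrs[of x] arrowD(5)[OF y] by blast
  next
    case False
    then show ?thesis using nbrs[of x] stage_mono[where S = S and P = P and m = n and n = "Suc n"] by auto
  qed
  { case 1
    show ?case
      using Suc.IH(1) arrowD(1-3) unfolding stage_Suc simple_graph_def irrefl_def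
      by (auto intro!: symI dest: symD) blast+ }
  { case 2
    show ?case using new[of x] Suc.IH(2)[of x] by (metis finite_insert finite_subset) }
  { case 3
    show ?case
    proof (cases "stage S P (Suc n) `` {x} = ?E `` {x}")
      case True
      then show ?thesis using Suc.IH(3)[of x] by (simp only: vertex_degree_def)
    next
      case False
      then obtain y where y: "vertex_degree ?E x < 2" "stage S P (Suc n) `` {x} \<subseteq> insert y (?E `` {x})"
        using new[of x] by blast
      have "card (stage S P (Suc n) `` {x}) \<le> card (insert y (?E `` {x}))"
        using y(2) Suc.IH(2)[of x] by (intro card_mono) auto
      also have "\<dots> \<le> Suc (card (?E `` {x}))" by (rule card_insert_le_m1) auto
      finally show ?thesis using y(1) unfolding vertex_degree_def by linarith
    qed }
qed

lemma core_edge_arrow: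
  assumes "(x, y) \<in> core S P"
  obtains n where "arrow S P (stage S P n) x y"
proof -
  have "\<exists>n. arrow S P (stage S P n) x y" if "(x, y) \<in> stage S P n" for n
    using that
  proof (induction n)
    case (Suc n)
    then show ?case unfolding stage_Suc by blast
  qed simp
  then show thesis using assms that by (auto simp: core_multi_matching_def)
qed

text \<open>
  A finite point-set allows only finitely many edges, and each of them appears at some stage.
\<close>

lemma core_is_stage:
  assumes "finite P"
  obtains n where "core S P = stage S P n"
proof -
  have "core S P \<subseteq> P \<times> P"
    using stage_graph(1)[where P = P and S = S] by (auto simp: core_multi_matching_def simple_graph_def)
  then have fin: "finite (core S P)" using assms finite_subset by blast
  have "\<forall>e\<in>core S P. \<exists>n. e \<in> stage S P n" by (auto simp: core_multi_matching_def)
  then obtain f where f: "\<And>e. e \<in> core S P \<Longrightarrow> e \<in> stage S P (f e)" by metis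
  obtain N where "\<forall>n\<in>f ` core S P. n \<le> N"
    using fin finite_nat_set_iff_bounded_le by blast
  then have "core S P \<subseteq> stage S P N" using f stage_mono by blast
  then show thesis using that stage_subset_core by blast
qed

lemma degree_mono:
  assumes "E \<subseteq> F" "finite (F `` {x})"
  shows "vertex_degree E x \<le> vertex_degree F x"
  unfolding vertex_degree_def using assms by (intro card_mono) auto

lemma stage_degree_mono:
  "m \<le> n \<Longrightarrow> vertex_degree (stage S P m) x \<le> vertex_degree (stage S P n) x"
  by (intro degree_mono stage_mono stage_graph(2))

text \<open>
  Compare the stages at which the edges appeared. When \<open>x\<close> pointed to \<open>z\<close>, the vertex \<open>y\<close> was no
  candidate, hence saturated. An edge of \<open>y\<close> at least as long as \<open>dist x y\<close> would
  likewise have appeared when \<open>x\<close> was saturated; neither of the two stages can come first.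
\<close>

lemma core_longer_edge:
  assumes fin: "finite P" and xy: "y \<in> P" "x \<noteq> y" "(x, y) \<notin> core S P"
    and xz: "(x, z) \<in> core S P" "dist x y \<le> dist x z"
  shows "vertex_degree (core S P) y = 2" "(y, w) \<in> core S P \<Longrightarrow> dist y w < dist x y"
proof -
  obtain N where N: "core S P = stage S P N" using core_is_stage[OF fin] .
  have fins: "finite (core S P `` {v})" "vertex_degree (core S P) v \<le> 2" for v
    using stage_graph[where P = P and S = S and n = N] N by auto
  have sym: "(y, x) \<notin> core S P"
    using stage_graph(1)[where P = P and S = S and n = N] N xy(3) by (auto simp: simple_graph_def dest: symD)
  have notin: "(x, y) \<notin> stage S P n" "(y, x) \<notin> stage S P n" for n
    using stage_subset_core[where S = S and P = P and n = n] xy(3) sym by auto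
  obtain n where n: "arrow S P (stage S P n) x z" using core_edge_arrow[OF xz(1)] .
  have zy: "z \<noteq> y" using xz(1) xy(3) by auto
  have sat: "\<not> vertex_degree (stage S P n) y < 2"
    using arrowD(8)[OF n xy(1)] xy(2) zy xz(2) notin by force
  then show "vertex_degree (core S P) y = 2"
    using degree_mono[OF stage_subset_core[where S = S and P = P and n = n] fins(1)[of y]] fins(2)[of y] by linarith
  show "dist y w < dist x y" if yw: "(y, w) \<in> core S P"
  proof (rule ccontr)
    assume ge: "\<not> dist y w < dist x y"
    obtain m where m: "arrow S P (stage S P m) y w" using core_edge_arrow[OF yw] .
    have "w \<noteq> x" using yw sym by auto
    then have "\<not> vertex_degree (stage S P m) x < 2"
      using arrowD(8)[OF m arrowD(1)[OF n]] xy(2) ge notin by (force simp: dist_commute)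
    then have "\<not> m \<le> n"
      using stage_degree_mono[where S = S and P = P and x = x, of m n] arrowD(5)[OF n] by linarith
    moreover have "\<not> n \<le> m"
      using stage_degree_mono[where S = S and P = P and x = y, of n m] arrowD(5)[OF m] sat by linarith
    ultimately show False by linarith
  qed
qed

lemma core_greedy: "finite P \<Longrightarrow> greedy_graph P (core S P)"
proof -
  assume fin: "finite P"
  obtain N where N: "core S P = stage S P N" using core_is_stage[OF fin] .
  show ?thesis
  proof
    show "simple_graph P (core S P)" "finite (core S P `` {x})" "vertex_degree (core S P) x \<le> 2" for x
      unfolding N by (rule stage_graph)+
    show "vertex_degree (core S P) y = 2 \<and> (\<forall>w. (y, w) \<in> core S P \<longrightarrow> dist y w \<le> dist x y)"
      if "y \<in> P" "x \<noteq> y" "(x, y) \<notin> core S P" "(x, z) \<in> core S P" "dist x y < dist x z" for x y z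
      using core_longer_edge[OF fin that(1-4)] that(5) by force
  qed
qed

lemma core_edge_inside:
  assumes "(x, y) \<in> core S P"
  shows "x \<in> P" "y \<in> P" "dist x y < infdist x (- S)"
  using assms arrowD core_edge_arrow by metis+

text \<open>
  A pair of mutually nearest candidates would be linked by the next step, but the algorithm has
  stopped. Distinct distances make a nearest candidate strictly nearest.
\<close>

lemma core_open_pairs_improvable:
  assumes fin: "finite P" and ties: "no_ties S P"
  shows "open_pairs_improvable (\<lambda>x. infdist x (- S)) P (core S P)"
  unfolding open_pairs_improvable_def
proof (intro ballI impI)
  fix x y
  assume xy: "x \<in> P" "y \<in> P" "x \<noteq> y" "(x, y) \<notin> core S P"
    and deg: "vertex_degree (core S P) x < 2" "vertex_degree (core S P) y < 2"
    and d: "dist x y < infdist x (- S)" "dist x y < infdist y (- S)"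
  interpret greedy_graph P "core S P" by (rule core_greedy[OF fin])
  obtain N where N: "core S P = stage S P N" using core_is_stage[OF fin] .
  have yx: "(y, x) \<notin> core S P" using xy(4) edge_sym by blast
  have tie: "dist a b \<noteq> dist a c" if "a \<in> P" "b \<in> P" "c \<in> P" "b \<noteq> a" "c \<noteq> a" "b \<noteq> c" for a b c
  proof
    assume "dist a b = dist a c"
    then have "core_dist S a (Some b) = core_dist S a (Some c)" by simp
    moreover have "inj_on (core_dist S a) (insert None (Some ` (P - {a})))"
      using ties that by (simp add: no_ties_def)
    ultimately have "Some b = Some c" using that by (elim inj_onD) auto
    then show False using that by simp
  qed
  show "\<exists>u\<in>P. vertex_degree (core S P) u < 2 \<and>
           (u \<noteq> x \<and> (x, u) \<notin> core S P \<and> dist x u < dist x y \<or>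
            u \<noteq> y \<and> (y, u) \<notin> core S P \<and> dist y u < dist x y)"
  proof (rule ccontr)
    assume no: "\<not> ?thesis"
    have "dist x y < dist x u" if "u \<in> P" "u \<noteq> x" "vertex_degree (core S P) u < 2" "(x, u) \<notin> core S P" "u \<noteq> y" for u
    proof -
      have "dist x u \<noteq> dist x y" using tie[of x u y] that xy by auto
      then show ?thesis using no that by force
    qed
    then have "arrow S P (core S P) x y" unfolding arrow_iff using xy deg d by blast
    moreover have "dist y x < dist y u" if "u \<in> P" "u \<noteq> y" "vertex_degree (core S P) u < 2" "(y, u) \<notin> core S P" "u \<noteq> x" for u
    proof -
      have "dist y u \<noteq> dist y x" using tie[of y u x] that xy by auto
      then show ?thesis using no that by (force simp: dist_commute[of y x])
    qed
    then have "arrow S P (core S P) y x"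
      unfolding arrow_iff using xy yx deg d by (auto simp: dist_commute[of y x])
    ultimately have "(x, y) \<in> stage S P (Suc N)" unfolding stage_Suc N by blast
    then show False using xy(4) stage_subset_core by blast
  qed
qed

text \<open>
  The core is insensitive to what happens outside \<open>S\<close>. Take two points joined by the algorithm
  while all earlier edges lie in \<open>E\<close>. All competitors nearer than the boundary lie in \<open>S\<close>, and
  a vertex that has a free stub in \<open>E\<close> still had one in the algorithm. So a reason for \<open>E\<close> to omit the pair, be
  it a shorter edge or a closer vertex with a free stub, would have kept the algorithm from joining it.
\<close>

lemma core_subset:
  assumes greedy: "greedy_graph V E"
    and improvable: "open_pairs_improvable (\<lambda>x. infdist x (- S)) V E"
  shows "core S (V \<inter> S) \<subseteq> E"
proof -
  interpret greedy_graph V E by (rule greedy)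
  let ?P = "V \<inter> S"
  have inside: "u \<in> ?P" if "u \<in> V" "dist x u < infdist x (- S)" for x u
    using infdist_le[of u "- S" x] that by (cases "u \<in> S") auto
  have "stage S ?P n \<subseteq> E" for n
  proof (induction n)
    case (Suc n)
    let ?F = "stage S ?P n"
    have open_before: "vertex_degree ?F u < 2" if "vertex_degree E u < 2" for u
      using degree_mono[OF Suc.IH finite_nbrs[of u]] that by linarith
    have not_full: "\<not> (vertex_degree E x = 2 \<and> (\<forall>w. (x, w) \<in> E \<longrightarrow> dist x w \<le> dist x y))"
      if a: "arrow S ?P ?F x y" and no: "(x, y) \<notin> E" for x y
    proof
      assume full: "vertex_degree E x = 2 \<and> (\<forall>w. (x, w) \<in> E \<longrightarrow> dist x w \<le> dist x y)"
      have "\<not> E `` {x} \<subseteq> ?F `` {x}"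
        using card_mono[OF stage_graph(2)[where S = S and P = ?P and n = n and x = x], of "E `` {x}"] full arrowD(5)[OF a]
        unfolding vertex_degree_def by linarith
      then obtain u where u: "(x, u) \<in> E" "(x, u) \<notin> ?F" by blast
      then have uP: "u \<in> ?P" "u \<noteq> x" "u \<noteq> y" "dist x u \<le> dist x y"
        using inside[of u x] full arrowD(7)[OF a] edge_in edge_neq no by force+
      have "\<not> vertex_degree ?F u < 2" using arrowD(8)[OF a uP(1,2) _ u(2) uP(3)] uP(4) by auto
      then have "?F `` {u} = E `` {u}"
        using degree_le[of u] Suc.IH finite_nbrs[of u] unfolding vertex_degree_def
        by (intro card_seteq) auto
      then have "(u, x) \<in> ?F" using edge_sym[OF u(1)] by blast
      then show False
        using stage_graph(1)[where S = S and P = ?P and n = n] u(2) by (auto simp: simple_graph_def dest: symD)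
    qed
    have "(x, y) \<in> E" if a: "arrow S ?P ?F x y" "arrow S ?P ?F y x" for x y
    proof (rule ccontr)
      assume no: "(x, y) \<notin> E"
      then have no': "(y, x) \<notin> E" using edge_sym by blast
      have V: "x \<in> V" "y \<in> V" "x \<noteq> y" using arrowD[OF a(1)] by auto
      have short: "\<not> dist x y < dist x z" if "(x, z) \<in> E" for z
        using longer_edge[OF V(2,3) no that] not_full[OF a(2) no'] by (auto simp: dist_commute)
      have short': "\<not> dist y x < dist y z" if "(y, z) \<in> E" for z
        using longer_edge[OF V(1) V(3)[symmetric] no' that] not_full[OF a(1) no] by (auto simp: dist_commute)
      have "vertex_degree E x < 2" "vertex_degree E y < 2"
        using not_full[OF a(1) no] not_full[OF a(2) no'] short short' degree_le[of x] degree_le[of y]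
        by (force simp: not_less)+
      then obtain u where u: "u \<in> V" "vertex_degree E u < 2"
        "u \<noteq> x \<and> (x, u) \<notin> E \<and> dist x u < dist x y \<or> u \<noteq> y \<and> (y, u) \<notin> E \<and> dist y u < dist x y"
        using improvable V no arrowD(7)[OF a(1)] arrowD(7)[OF a(2)]
        unfolding open_pairs_improvable_def by (metis dist_commute)
      have False if "arrow S ?P ?F x y" "u \<noteq> x" "(x, u) \<notin> E" "dist x u < dist x y" for x y
      proof -
        have "u \<in> ?P" using inside[OF u(1), of x] that(4) arrowD(7)[OF that(1)] by simp
        then have "dist x y < dist x u"
          using arrowD(8)[OF that(1), of u] open_before[OF u(2)] that Suc.IH by auto
        then show False using that(4) by simp
      qed
      then show False using u(3) a by (metis dist_commute)
    qed
    then show ?case using Suc.IH unfolding stage_Suc by auto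
  qed simp
  then show ?thesis by (auto simp: core_multi_matching_def)
qed

section \<open>Good intervals\<close>

abbreviation core_on :: "real set \<Rightarrow> real \<Rightarrow> real \<Rightarrow> (real \<times> real) set" where
  "core_on V a b \<equiv> core {a..b} (V \<inter> {a..b})"

lemma core_sym: "(x, y) \<in> core S P \<Longrightarrow> (y, x) \<in> core S P"
proof -
  assume "(x, y) \<in> core S P"
  then obtain n where "(x, y) \<in> stage S P n" by (auto simp: core_multi_matching_def)
  then have "(y, x) \<in> stage S P n"
    using stage_graph(1)[where P = P and S = S and n = n] by (auto simp: simple_graph_def dest: symD)
  then show ?thesis using stage_subset_core by blast
qed

lemma core_connected_sym: "(x, y) \<in> (core S P)\<^sup>* \<Longrightarrow> (y, x) \<in> (core S P)\<^sup>*"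
  using sym_rtrancl[OF symI[OF core_sym]] by (rule symD)

lemma good_interval_iff:
  "good_interval V a b \<longleftrightarrow>
     (\<exists>p\<in>V \<inter> {a..b}. \<exists>q\<in>V \<inter> {a..b}. p \<le> 3/4 * a + 1/4 * b \<and> 1/4 * a + 3/4 * b \<le> q \<and>
        (p, q) \<in> (core_on V a b)\<^sup>*)" (is "?L \<longleftrightarrow> ?R")
proof
  assume ?L
  then obtain C p q where C: "C \<in> graph_components (V \<inter> {a..b}) (core_on V a b)"
    and pq: "p \<in> C" "p \<in> {a..3/4 * a + 1/4 * b}" "q \<in> C" "q \<in> {1/4 * a + 3/4 * b..b}"
    unfolding good_interval_def by blast
  obtain x where "C = {y \<in> V \<inter> {a..b}. (x, y) \<in> (core_on V a b)\<^sup>*}"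
    using C unfolding graph_components_def by blast
  then have "p \<in> V \<inter> {a..b}" "q \<in> V \<inter> {a..b}" "(x, p) \<in> (core_on V a b)\<^sup>*" "(x, q) \<in> (core_on V a b)\<^sup>*"
    using pq by blast+
  moreover have "p \<le> 3/4 * a + 1/4 * b" "1/4 * a + 3/4 * b \<le> q" using pq by simp_all
  moreover have "(p, q) \<in> (core_on V a b)\<^sup>*"
    by (rule rtrancl_trans[OF core_connected_sym[OF calculation(3)] calculation(4)])
  ultimately show ?R by blast
next
  assume ?R
  then obtain p q where pq: "p \<in> V \<inter> {a..b}" "q \<in> V \<inter> {a..b}" "p \<le> 3/4 * a + 1/4 * b"
    "1/4 * a + 3/4 * b \<le> q" "(p, q) \<in> (core_on V a b)\<^sup>*" by blast
  let ?C = "{y \<in> V \<inter> {a..b}. (p, y) \<in> (core_on V a b)\<^sup>*}"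
  have C: "?C \<in> graph_components (V \<inter> {a..b}) (core_on V a b)"
    unfolding graph_components_def using pq(1) by blast
  have "p \<in> ?C \<inter> {a..3/4 * a + 1/4 * b}" "q \<in> ?C \<inter> {1/4 * a + 3/4 * b..b}"
    using pq by auto
  then have meets: "?C \<inter> {a..3/4 * a + 1/4 * b} \<noteq> {}" "?C \<inter> {1/4 * a + 3/4 * b..b} \<noteq> {}"
    by (simp_all only: ex_in_conv[symmetric]) (rule exI, assumption)+
  show ?L unfolding good_interval_def by (intro bexI[OF _ C] conjI meets)
qed

text \<open>
  The infimum is not attained, as the complement of a closed interval is open.
\<close>

lemma infdist_interval:
  fixes x a b :: real
  assumes "a \<le> x" "x \<le> b"
  shows "infdist x (- {a..b}) = min (x - a) (b - x)"
proof (rule antisym)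
  have "infdist x (- {a..b}) \<le> min (x - a) (b - x) + e" if "e > 0" for e
  proof -
    have "infdist x (- {a..b}) \<le> dist x (a - e)" "infdist x (- {a..b}) \<le> dist x (b + e)"
      using that by (intro infdist_le; simp)+
    then show ?thesis using assms that by (auto simp: dist_real_def)
  qed
  then show "infdist x (- {a..b}) \<le> min (x - a) (b - x)" by (rule field_le_epsilon)
  have ne: "- {a..b} \<noteq> {}" by (metis Compl_iff atLeastAtMost_iff empty_iff gt_ex not_le)
  show "min (x - a) (b - x) \<le> infdist x (- {a..b})"
    unfolding infdist_notempty[OF ne]
    by (rule cINF_greatest[OF ne]) (use assms in \<open>auto simp: dist_real_def\<close>)
qed

lemma core_on_edge:
  assumes "(x, y) \<in> core_on V a b"
  shows "x \<in> V" "a \<le> x" "x \<le> b" "y \<in> V" "a \<le> y" "y \<le> b" "3 * dist x y < b - a"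
proof -
  have xy: "x \<in> V \<inter> {a..b}" "y \<in> V \<inter> {a..b}" "dist x y < infdist x (- {a..b})"
    using core_edge_inside[OF assms] by auto
  have yx: "dist y x < infdist y (- {a..b})" using core_edge_inside(3)[OF core_sym[OF assms]] .
  show "x \<in> V" "a \<le> x" "x \<le> b" "y \<in> V" "a \<le> y" "y \<le> b" using xy by auto
  then show "3 * dist x y < b - a"
    using xy(3) yx by (simp add: infdist_interval dist_real_def abs_if split: if_splits)
qed

section \<open>Joining components of a greedy graph on the line\<close>

context greedy_line
begin

text \<open>
  If the components differed, \<open>component_enclosed\<close> would confine the second one below an edge
  of the first crossing, but it reaches beyond \<open>b\<close>.
\<close>

lemma crossings_meet:
  assumes F: "F \<subseteq> E" "(p, q) \<in> F\<^sup>*" "\<And>u v. (u, v) \<in> F \<Longrightarrow> v \<le> b"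
    and p': "(p', q') \<in> E\<^sup>*" "p \<le> p'" "p' \<le> q" "b < q'"
  shows "(p, p') \<in> E\<^sup>*"
proof (rule ccontr)
  assume no: "(p, p') \<notin> E\<^sup>*"
  have "(p, q) \<in> E\<^sup>*" using F(1,2) rtrancl_mono by blast
  then have "p < p'" "p' < q" using no p' by (auto simp: le_less)
  then show False
    using component_enclosed[OF F(1,2) _ _ no] p'(1,4) F(3) by (metis less_trans not_le)
qed

text \<open>
  Discarding long edges corresponds to stopping the greedy construction early.
\<close>

lemma short_edges_greedy: "greedy_line V {(x, y) \<in> E. dist x y < \<rho>}"
proof -
  let ?G = "{(x, y) \<in> E. dist x y < \<rho>}"
  have GE: "?G \<subseteq> E" by auto
  show ?thesis
  proof
    have "sym ?G" by (intro symI) (auto simp: dist_commute dest: edge_sym)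
    moreover have "irrefl ?G" using edge_neq by (intro irreflI) blast
    ultimately show "simple_graph V ?G" using edge_in by (auto simp: simple_graph_def)
    show "finite (?G `` {x})" for x using finite_nbrs[of x] by (rule rev_finite_subset) auto
    show "vertex_degree ?G x \<le> 2" for x
      using degree_mono[OF GE finite_nbrs[of x]] degree_le[of x] by linarith
    fix x y z
    assume a: "y \<in> V" "x \<noteq> y" "(x, y) \<notin> ?G" "(x, z) \<in> ?G" "dist x y < dist x z"
    then have "(x, y) \<notin> E" "(x, z) \<in> E" by auto
    then have full: "vertex_degree E y = 2" "\<And>w. (y, w) \<in> E \<Longrightarrow> dist y w \<le> dist x y"
      using longer_edge[OF a(1,2) _ _ a(5)] by auto
    then have "?G `` {y} = E `` {y}" using a(4,5) by force
    then show "vertex_degree ?G y = 2 \<and> (\<forall>w. (y, w) \<in> ?G \<longrightarrow> dist y w \<le> dist x y)"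
      using full by (simp add: vertex_degree_def)
  qed
qed

text \<open>
  A component of width at least \<open>\<rho>\<close> does not fit below an edge of another component, so two wide
  components cannot interlace.
\<close>

lemma components_ordered:
  assumes short: "\<And>x y. (x, y) \<in> E \<Longrightarrow> dist x y < \<rho>"
    and pq: "(p, q) \<in> E\<^sup>*" "q - p \<ge> \<rho>" and pq': "(p', q') \<in> E\<^sup>*" "q' - p' \<ge> \<rho>"
    and apart: "(p, p') \<notin> E\<^sup>*" and less: "p < p'"
    and xy: "(p, x) \<in> E\<^sup>*" "(p', y) \<in> E\<^sup>*"
  shows "x < y"
proof -
  have nest: False
    if sc: "(s, c) \<in> E\<^sup>*" "s < b" "b < c" "(s, b) \<notin> E\<^sup>*"
      and bt: "(b, t) \<in> E\<^sup>*" "(b, t') \<in> E\<^sup>*" "t' - t \<ge> \<rho>" for s c b t t'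
  proof -
    obtain u v where uv: "(u, v) \<in> E" "\<And>z. (b, z) \<in> E\<^sup>* \<Longrightarrow> u < z \<and> z < v"
      using component_enclosed[OF order_refl sc] by blast
    have "u < t" "t' < v" using uv(2) bt by auto
    then show False using short[OF uv(1)] bt(3) by (auto simp: dist_real_def)
  qed
  have apart': "(p, y) \<notin> E\<^sup>*" using apart xy(2) connected_sym by (meson rtrancl_trans)
  then have "x \<noteq> y" "p \<noteq> y" using xy by auto
  have yp': "(y, p') \<in> E\<^sup>*" using xy connected_sym by blast
  have "p < y"
  proof (rule ccontr)
    assume "\<not> p < y"
    then have "y < p" using \<open>p \<noteq> y\<close> by simp
    then show False
      using nest[of y p' p p q] yp' less pq apart' connected_sym by blast
  qed
  show ?thesis
  proof (rule ccontr)
    assume "\<not> x < y"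
    then have "y < x" using \<open>x \<noteq> y\<close> by simp
    then show False
      using nest[of p x y p' q'] xy \<open>p < y\<close> apart' yp' pq' by (meson rtrancl_trans)
  qed
qed

text \<open>
  Suppose the two components differ. Restrict them to edges shorter than \<open>l\<close>, and consider the right
  end \<open>x\<close> of the left one and the left end \<open>y\<close> of the right one. Both have a free stub, and they keep it:
  a longer edge at either of them would, by greediness, require the other to be saturated by short
  edges. Now look at the closest unlinked pair of vertices with free stubs in \<open>[x, y]\<close>. A vertex with a
  free stub that is even closer to one of them would lie in \<open>[x, y]\<close>, which contradicts the choice, or
  less than \<open>l\<close> behind \<open>x\<close> or \<open>y\<close>, where the widths of the components leave only saturated vertices.
\<close>

lemma gap_is_bridged:
  assumes fin: "finite V"
    and strict: "\<And>x y z w. y \<in> V \<Longrightarrow> x \<noteq> y \<Longrightarrow> (x, y) \<notin> E \<Longrightarrow> (x, z) \<in> E \<Longrightarrow> dist x y \<le> dist x z \<Longrightarrow>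
        vertex_degree E y = 2 \<and> ((y, w) \<in> E \<longrightarrow> dist y w < dist x y)"
    and improvable: "open_pairs_improvable r V E"
    and G: "G = {(x, y) \<in> E. dist x y < l}"
    and pq: "p \<in> V" "(p, q) \<in> G\<^sup>*" "q - p \<ge> l"
    and pq': "p' \<in> V" "(p', q') \<in> G\<^sup>*" "q' - p' \<ge> l"
    and gap: "p < p'" "p' - q \<le> l"
    and deep: "\<And>z. q \<le> z \<Longrightarrow> z \<le> p' \<Longrightarrow> l < r z"
  shows "(p, p') \<in> E\<^sup>*"
proof (rule ccontr)
  assume no: "(p, p') \<notin> E\<^sup>*"
  interpret G: greedy_line V G unfolding G by (rule short_edges_greedy)
  have GE: "G \<subseteq> E" using G by auto
  then have GE': "G\<^sup>* \<subseteq> E\<^sup>*" by (rule rtrancl_mono)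
  have Gshort: "dist x y < l" if "(x, y) \<in> G" for x y using that G by auto
  let ?A = "G\<^sup>* `` {p}" and ?B = "G\<^sup>* `` {p'}"
  have "?A \<subseteq> V" "?B \<subseteq> V" using G.connected_in pq(1) pq'(1) by auto
  then have finAB: "finite ?A" "finite ?B" using fin finite_subset by auto
  define x where "x = Max ?A"
  define y where "y = Min ?B"
  have A: "(p, x) \<in> G\<^sup>*" "\<And>z. (p, z) \<in> G\<^sup>* \<Longrightarrow> z \<le> x"
    using Max_in[OF finAB(1)] Max_ge[OF finAB(1)] unfolding x_def by auto
  have B: "(p', y) \<in> G\<^sup>*" "\<And>z. (p', z) \<in> G\<^sup>* \<Longrightarrow> y \<le> z"
    using Min_in[OF finAB(2)] Min_le[OF finAB(2)] unfolding y_def by auto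
  have qx: "q \<le> x" and yp': "y \<le> p'" using A(2) B(2) pq(2) by auto
  have xy: "x < y"
    using G.components_ordered[OF Gshort pq(2,3) pq'(2,3) _ gap(1) A(1) B(1)] no GE' by blast
  have V: "x \<in> V" "y \<in> V" using G.connected_in A(1) B(1) pq(1) pq'(1) by auto
  have apart: "(x, y) \<notin> E\<^sup>*"
  proof
    assume "(x, y) \<in> E\<^sup>*"
    moreover have "(p, x) \<in> E\<^sup>*" "(y, p') \<in> E\<^sup>*" using A(1) B(1) GE' connected_sym by auto
    ultimately show False using no by (meson rtrancl_trans)
  qed
  then have unlinked: "(x, y) \<notin> E" "(y, x) \<notin> E" using edge_sym by auto
  have "vertex_degree G x \<noteq> 2"
    by (rule G.right_end_open[OF finAB(1) Gshort _ A]) (use pq(3) qx in auto)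
  moreover have "vertex_degree G y \<noteq> 2"
  proof (rule G.left_end_open[of q' l])
    have "(q', z) \<in> G\<^sup>* \<longleftrightarrow> (p', z) \<in> G\<^sup>*" for z
      using pq'(2) G.connected_sym by (meson rtrancl_trans)
    then show "finite (G\<^sup>* `` {q'})" "(q', y) \<in> G\<^sup>*" "\<And>z. (q', z) \<in> G\<^sup>* \<Longrightarrow> y \<le> z"
      using finAB(2) B by (auto simp: Image_def)
  qed (use Gshort pq'(3) yp' in auto)
  ultimately have openG: "vertex_degree G x \<noteq> 2" "vertex_degree G y \<noteq> 2" by auto
  have dxy: "dist x y \<le> l" using xy qx yp' gap by (simp add: dist_real_def)
  \<comment> \<open>applied with \<open>{s, t} = {x, y}\<close>: neither of them has an edge of length \<open>l\<close> or more\<close>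
  have no_long: "(s, z) \<in> G" if "(s, z) \<in> E" "s \<noteq> t" "(s, t) \<notin> E" "dist s t \<le> l" "t \<in> V" "vertex_degree G t \<noteq> 2" for s t z
  proof (rule ccontr)
    assume "(s, z) \<notin> G"
    then have "dist s t \<le> dist s z" using that G by auto
    then have full: "vertex_degree E t = 2" "\<And>w. (t, w) \<in> E \<Longrightarrow> dist t w < dist s t"
      using strict[OF that(5,2,3,1)] by auto
    then have "G `` {t} = E `` {t}" using G that(4) by force
    then show False using full that(6) by (simp add: vertex_degree_def)
  qed
  have "G `` {x} = E `` {x}" using no_long[of x _ y] unlinked dxy V xy openG GE by blast
  then have openx: "vertex_degree E x < 2"
    using openG(1) degree_le[of x] by (simp add: vertex_degree_def)
  have "G `` {y} = E `` {y}"
    using no_long[of y _ x] unlinked dxy V xy openG GE by (auto simp: dist_commute)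
  then have openy: "vertex_degree E y < 2"
    using openG(2) degree_le[of y] by (simp add: vertex_degree_def)
  define Z where "Z = {z \<in> V. x \<le> z \<and> z \<le> y \<and> vertex_degree E z < 2}"
  \<comment> \<open>the unlinked pairs of vertices with a free stub between the two ends\<close>
  define W where "W = {(s, t) \<in> Z \<times> Z. s \<noteq> t \<and> (s, t) \<notin> E}"
  have "finite Z" using fin by (simp add: Z_def)
  then have finW: "finite W" unfolding W_def by (auto intro: finite_subset[of _ "Z \<times> Z"])
  have xyW: "(x, y) \<in> W" using xy V openx openy unlinked by (simp add: W_def Z_def)
  obtain s t where st: "(s, t) \<in> W" "\<And>s' t'. (s', t') \<in> W \<Longrightarrow> dist s t \<le> dist s' t'"
    using arg_min_if_finite(1,2)[OF finW, of "\<lambda>(s, t). dist s t"] xyW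
    by (metis (mono_tags, lifting) case_prod_conv empty_iff not_le surj_pair)
  have stZ: "s \<in> Z" "t \<in> Z" "s \<noteq> t" "(s, t) \<notin> E" using st(1) by (auto simp: W_def)
  have dst: "dist s t \<le> y - x" using st(2)[OF xyW] xy by (simp add: dist_real_def)
  have "y - x \<le> l" using dxy xy by (simp add: dist_real_def)
  then have "dist s t < r s" "dist s t < r t"
    using deep[of s] deep[of t] stZ qx yp' dst by (auto simp: Z_def)
  then obtain u where u: "u \<in> V" "vertex_degree E u < 2"
      "u \<noteq> s \<and> (s, u) \<notin> E \<and> dist s u < dist s t \<or> u \<noteq> t \<and> (t, u) \<notin> E \<and> dist t u < dist s t"
    using improvable stZ unfolding open_pairs_improvable_def Z_def by blast
  have openGu: "vertex_degree G u \<noteq> 2"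
    using degree_mono[OF GE finite_nbrs[of u]] u(2) by linarith
  obtain c where c: "c \<in> Z" "u \<noteq> c" "(c, u) \<notin> E" "dist c u < dist s t"
    using u(3) stZ by blast
  have "x \<le> u"
  proof (rule ccontr)
    assume "\<not> x \<le> u"
    moreover from this have "p < u" using c dst \<open>y - x \<le> l\<close> pq(3) qx by (auto simp: Z_def dist_real_def)
    ultimately show False
      using G.between_connected_saturated[OF A(1), of u] u(1) openGu by auto
  qed
  moreover have "u \<le> y"
  proof (rule ccontr)
    assume "\<not> u \<le> y"
    moreover from this have "u < q'" using c dst \<open>y - x \<le> l\<close> pq'(3) yp' by (auto simp: Z_def dist_real_def)
    moreover have "(y, q') \<in> G\<^sup>*" using B(1) pq'(2) G.connected_sym by (meson rtrancl_trans)
    ultimately show False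
      using G.between_connected_saturated[of y q' u] u(1) openGu by auto
  qed
  ultimately have "(c, u) \<in> W" using u c by (simp add: W_def Z_def)
  then show False using st(2)[of c u] c(4) by simp
qed

end

section \<open>Renormalisation of good intervals\<close>

lemma open_pairs_improvable_mono:
  "open_pairs_improvable r V E \<Longrightarrow> (\<And>x. r' x \<le> r x) \<Longrightarrow> open_pairs_improvable r' V E"
  unfolding open_pairs_improvable_def by (meson less_le_trans)

lemma core_on_mono:
  assumes "finite (V \<inter> {a..b})" "no_ties {a..b} (V \<inter> {a..b})" "a \<le> a'" "b' \<le> b"
  shows "core_on V a' b' \<subseteq> core_on V a b"
proof -
  have ne: "- {a..b} \<noteq> {}" by (metis Compl_iff atLeastAtMost_iff empty_iff gt_ex not_le)
  have "infdist x (- {a'..b'}) \<le> infdist x (- {a..b})" for x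
    using ne assms by (intro infdist_mono) auto
  then have "open_pairs_improvable (\<lambda>x. infdist x (- {a'..b'})) (V \<inter> {a..b}) (core_on V a b)"
    by (rule open_pairs_improvable_mono[OF core_open_pairs_improvable[OF assms(1,2)]])
  then have "core {a'..b'} ((V \<inter> {a..b}) \<inter> {a'..b'}) \<subseteq> core_on V a b"
    by (rule core_subset[OF core_greedy[OF assms(1)]])
  moreover have "(V \<inter> {a..b}) \<inter> {a'..b'} = V \<inter> {a'..b'}" using assms(3,4) by auto
  ultimately show ?thesis by simp
qed

lemma good_interval_crossing:
  assumes "good_interval V a (a + l)"
  obtains p q where "p \<in> V" "a \<le> p" "p \<le> a + l/4" "q \<in> V" "a + 3/4 * l \<le> q" "q \<le> a + l"
    "(p, q) \<in> (core_on V a (a + l))\<^sup>*"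
proof -
  obtain p q where "p \<in> V \<inter> {a..a + l}" "q \<in> V \<inter> {a..a + l}"
    and le: "p \<le> 3/4 * a + 1/4 * (a + l)" "1/4 * a + 3/4 * (a + l) \<le> q"
    and "(p, q) \<in> (core_on V a (a + l))\<^sup>*"
    using assms unfolding good_interval_iff by blast
  moreover have "p \<le> a + l/4" "a + 3/4 * l \<le> q" using le by argo+
  ultimately show thesis using that[of p q] by simp
qed

text \<open>
  Write \<open>pair k\<close> if the short intervals \<open>k\<close> and \<open>k + 1\<close> are good. Since bad intervals never occur at
  index distance two, a run of bad ones has length at most two and is followed by two good ones. Hence
  from a pair \<open>k\<close> one reaches the pair \<open>k + 1\<close> by overlap, or the pair \<open>k + 3\<close> or \<open>k + 4\<close> across a gap.
  The crossing of a pair has width at least \<open>l\<close>, and its right end is at most \<open>l\<close> away from the left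
  end of the crossing behind the gap, which is what \<open>gap_is_bridged\<close> needs. A pair with index at most
  \<open>3\<close> exists and starts in the first quarter of the long interval, and a pair with index at least \<open>8\<close>
  ends in the last quarter.
\<close>

lemma good_interval_renormalise:
  fixes V :: "real set" and a l :: real
  defines "good \<equiv> \<lambda>k::nat. good_interval V (a + k * l/2) (a + k * l/2 + l)"
  assumes fin: "finite (V \<inter> {a..a + 7 * l})" and ties: "no_ties {a..a + 7 * l} (V \<inter> {a..a + 7 * l})"
    and l: "l > 0" and spread: "\<And>k. k \<le> 10 \<Longrightarrow> good k \<or> good (k + 2)"
  shows "good_interval V a (a + 7 * l)"
proof -
  let ?J = "{a..a + 7 * l}" and ?P = "V \<inter> {a..a + 7 * l}" and ?E = "core_on V a (a + 7 * l)"
  define s where "s k = a + real k * l/2" for k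
  have s_le: "s k \<le> a + 6 * l" if "k \<le> 12" for k
  proof -
    have "real k * l \<le> 12 * l" using that l by (intro mult_right_mono) auto
    then show ?thesis by (simp add: s_def)
  qed
  have s_ge: "a \<le> s k" for k using l by (simp add: s_def)
  have s_add: "s (k + n) = s k + real n * l/2" for k n by (simp add: s_def field_simps)
  interpret E: greedy_line ?P ?E
    unfolding greedy_line_def by (rule core_greedy[OF fin])
  define G where "G = {(x, y) \<in> ?E. dist x y < l}"
  interpret G: greedy_line ?P G unfolding G_def by (rule E.short_edges_greedy)
  have GE: "G\<^sup>* \<subseteq> ?E\<^sup>*" by (rule rtrancl_mono) (auto simp: G_def)
  have FG: "core_on V (s k) (s k + l) \<subseteq> G" if "k \<le> 12" for k
  proof -
    have "core_on V (s k) (s k + l) \<subseteq> ?E"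
      by (rule core_on_mono[OF fin ties]) (use s_le[OF that] s_ge in auto)
    then show ?thesis using core_on_edge(7)[of _ _ "s k" "s k + l" V] l unfolding G_def by force
  qed
  have "\<exists>p q. good k \<longrightarrow> p \<in> V \<and> s k \<le> p \<and> p \<le> s k + l/4 \<and> q \<in> V \<and> s k + 3/4 * l \<le> q \<and> q \<le> s k + l \<and>
      (p, q) \<in> (core_on V (s k) (s k + l))\<^sup>*" for k
  proof (cases "good k")
    case True
    then have "good_interval V (s k) (s k + l)" by (simp add: good_def s_def)
    then show ?thesis using good_interval_crossing by metis
  qed simp
  then obtain p q where pq: "good k \<Longrightarrow> p k \<in> V \<and> s k \<le> p k \<and> p k \<le> s k + l/4 \<and>
      q k \<in> V \<and> s k + 3/4 * l \<le> q k \<and> q k \<le> s k + l \<and>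
      (p k, q k) \<in> (core_on V (s k) (s k + l))\<^sup>*" for k
    by metis
  have pqG: "(p k, q k) \<in> G\<^sup>*" if "good k" "k \<le> 12" for k
    using pq[OF that(1)] rtrancl_mono[OF FG[OF that(2)]] by blast
  have pP: "p k \<in> ?P" if "good k" "k \<le> 12" for k
    using pq[OF that(1)] s_le[OF that(2)] s_ge[of k] l by auto
  have next_to: "(p k, p (Suc k)) \<in> G\<^sup>*" if "good k" "good (Suc k)" "Suc k \<le> 12" for k
  proof (rule G.crossings_meet[OF FG])
    show "(p k, q k) \<in> (core_on V (s k) (s k + l))\<^sup>*" using pq that by blast
    show "v \<le> s k + l" if "(u, v) \<in> core_on V (s k) (s k + l)" for u v
      using core_on_edge(6)[OF that] .
    show "(p (Suc k), q (Suc k)) \<in> G\<^sup>*" by (rule pqG) (use that in auto)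
  qed (use pq[of k] pq[of "Suc k"] that s_add[of k 1] l in auto)
  define pair where "pair k \<longleftrightarrow> good k \<and> good (Suc k)" for k
  have pairG: "(p k, q (Suc k)) \<in> G\<^sup>*" if "pair k" "Suc k \<le> 12" for k
    using next_to[of k] pqG[of "Suc k"] that by (auto simp: pair_def intro: rtrancl_trans)
  have bridge: "(p k, p m) \<in> ?E\<^sup>*" if k: "pair k" and m: "pair m" "m = k + 3 \<or> m = k + 4" "Suc m \<le> 12" for k m
  proof (rule E.gap_is_bridged[OF fin _ core_open_pairs_improvable[OF fin ties] G_def])
    have sk: "s (Suc k) = s k + l/2" using s_add[of k 1] by simp
    have sm: "s (Suc m) = s m + l/2" using s_add[of m 1] by simp
    have skm: "s k + 3/2 * l \<le> s m" "s m \<le> s k + 2 * l" using m(2) s_add[of k 3] s_add[of k 4] l by auto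
    note bounds = pq[of k] pq[of "Suc k"] pq[of m] pq[of "Suc m"] k m(1) pair_def
    show "p k \<in> ?P" "p m \<in> ?P" using pP k m by (auto simp: pair_def)
    show "(p k, q (Suc k)) \<in> G\<^sup>*" "(p m, q (Suc m)) \<in> G\<^sup>*" using pairG k m by auto
    show "l \<le> q (Suc k) - p k" "l \<le> q (Suc m) - p m" using bounds sk sm by auto
    show "p k < p m" using bounds skm l by auto
    show "p m - q (Suc k) \<le> l" using bounds skm sk by auto
    show "vertex_degree ?E y = 2 \<and> ((y, w) \<in> ?E \<longrightarrow> dist y w < dist x y)"
      if "y \<in> ?P" "x \<noteq> y" "(x, y) \<notin> ?E" "(x, z) \<in> ?E" "dist x y \<le> dist x z" for x y z w
      using core_longer_edge[OF fin that] by blast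
    fix z assume z: "q (Suc k) \<le> z" "z \<le> p m"
    have "s (Suc m) \<le> a + 6 * l" using s_le m(3) by blast
    then have "a + l < z" "z < a + 6 * l" using z bounds sk sm s_ge[of k] l by auto
    then show "l < infdist z (- ?J)" using l by (simp add: infdist_interval)
  qed
  have climb: "\<exists>m. 8 \<le> m \<and> m \<le> 11 \<and> pair m \<and> (p k, p m) \<in> ?E\<^sup>*" if "pair k" "k \<le> 11" for k
    using that
  proof (induction "11 - k" arbitrary: k rule: less_induct)
    case less
    show ?case
    proof (cases "8 \<le> k")
      case True
      then show ?thesis using less.prems by blast
    next
      case False
      have "\<exists>m. k < m \<and> m \<le> 11 \<and> pair m \<and> (p k, p m) \<in> ?E\<^sup>*"
      proof (cases "good (k + 2)")
        case True
        then have "pair (Suc k)" using less.prems by (simp add: pair_def)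
        moreover have "(p k, p (Suc k)) \<in> ?E\<^sup>*"
          using next_to[of k] less.prems False GE by (auto simp: pair_def)
        ultimately show ?thesis using False by (intro exI[of _ "Suc k"]) auto
      next
        case no2: False
        then have 4: "good (k + 4)" using spread[of "k + 2"] False by (simp add: numeral_eq_Suc)
        show ?thesis
        proof (cases "good (k + 3)")
          case True
          then have "pair (k + 3)" using 4 by (simp add: pair_def numeral_eq_Suc)
          then show ?thesis using bridge[of k "k + 3"] less.prems False by (intro exI[of _ "k + 3"]) auto
        next
          case no3: False
          then have "good (k + 5)" using spread[of "k + 3"] False by (simp add: numeral_eq_Suc)
          then have "pair (k + 4)" using 4 by (simp add: pair_def numeral_eq_Suc)
          then show ?thesis using bridge[of k "k + 4"] less.prems False by (intro exI[of _ "k + 4"]) auto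
        qed
      qed
      then obtain m where m: "k < m" "m \<le> 11" "pair m" "(p k, p m) \<in> ?E\<^sup>*" by blast
      then obtain m' where "8 \<le> m'" "m' \<le> 11" "pair m'" "(p m, p m') \<in> ?E\<^sup>*"
        using less.hyps[of m] by (metis diff_less_mono2 less_le_trans)
      then show ?thesis using m(4) by (meson rtrancl_trans)
    qed
  qed
  have "\<exists>k\<le>3. pair k"
  proof -
    have "pair 0 \<or> pair 1 \<or> pair 2 \<or> pair 3"
      using spread[of 0] spread[of 1] spread[of 2] by (auto simp: pair_def numeral_eq_Suc)
    then show ?thesis by (elim disjE) (rule exI, rule conjI[rotated], assumption, simp)+
  qed
  then obtain k where k: "k \<le> 3" "pair k" by blast
  then obtain m where m: "8 \<le> m" "m \<le> 11" "pair m" "(p k, p m) \<in> ?E\<^sup>*" using climb[of k] by auto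
  have good: "good k" "good (Suc m)" using k m by (auto simp: pair_def)
  have "(p k, q (Suc m)) \<in> ?E\<^sup>*"
    using rtrancl_trans[OF m(4) subsetD[OF GE pairG[OF m(3)]]] m(2) by simp
  moreover have "p k \<le> 3/4 * a + 1/4 * (a + 7 * l)"
  proof -
    have "real k * l \<le> 3 * l" using k l by (intro mult_right_mono) auto
    moreover have "p k \<le> s k + l/4" using pq[OF good(1)] by blast
    ultimately show ?thesis unfolding s_def by argo
  qed
  moreover have "1/4 * a + 3/4 * (a + 7 * l) \<le> q (Suc m)"
  proof -
    have "9 * l \<le> real (Suc m) * l" using m l by (intro mult_right_mono) auto
    moreover have "s (Suc m) + 3/4 * l \<le> q (Suc m)" using pq[OF good(2)] by blast
    ultimately show ?thesis unfolding s_def by argo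
  qed
  moreover have "p k \<in> ?P" "q (Suc m) \<in> ?P"
    using pP[OF good(1)] k pq[OF good(2)] s_ge[of "Suc m"] s_le[of "Suc m"] m l by auto
  ultimately show ?thesis unfolding good_interval_iff by blast
qed

section \<open>The stable multi-matching of a configuration with large good intervals\<close>

text \<open>
  Saturated vertices turn the disjunctive stability condition into the greedy one.
\<close>

lemma stable_multi_matching_greedy:
  assumes "is_stable_multi_matching V E"
  shows "greedy_graph V E"
proof
  show graph: "simple_graph V E" using assms by (simp add: is_stable_multi_matching_def)
  have deg: "vertex_degree E x = 2" if "x \<in> V" for x
    using assms that by (simp add: is_stable_multi_matching_def)
  have empty: "E `` {x} = {}" if "x \<notin> V" for x
    using graph that by (auto simp: simple_graph_def)
  show "finite (E `` {x})" for x
  proof (cases "x \<in> V")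
    case True
    then have "card (E `` {x}) \<noteq> 0" using deg[OF True] by (simp add: vertex_degree_def)
    then show ?thesis by (rule contrapos_np) simp
  qed (simp add: empty)
  show "vertex_degree E x \<le> 2" for x
    using deg[of x] empty[of x] by (cases "x \<in> V") (auto simp: vertex_degree_def)
  fix x y z
  assume a: "y \<in> V" "x \<noteq> y" "(x, y) \<notin> E" "(x, z) \<in> E" "dist x y < dist x z"
  have "x \<in> V" using graph a(4) by (auto simp: simple_graph_def)
  then have "(\<forall>z. (x, z) \<in> E \<longrightarrow> dist x z \<le> dist x y) \<or> (\<forall>z. (y, z) \<in> E \<longrightarrow> dist y z \<le> dist x y)"
    using assms a unfolding is_stable_multi_matching_def by blast
  then show "vertex_degree E y = 2 \<and> (\<forall>w. (y, w) \<in> E \<longrightarrow> dist y w \<le> dist x y)"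
    using deg[OF a(1)] a(4,5) by force
qed

lemma core_on_subset_stable:
  assumes "is_stable_multi_matching V E"
  shows "core_on V a b \<subseteq> E"
proof (rule core_subset[OF stable_multi_matching_greedy[OF assms]])
  show "open_pairs_improvable (\<lambda>x. infdist x (- {a..b})) V E"
    using assms unfolding open_pairs_improvable_def is_stable_multi_matching_def
    by (metis less_irrefl)
qed

text \<open>
  The cores of the intervals increase to a graph contained in every stable multi-matching. A good interval
  contains a path which passes over every point of its middle half, so that point is saturated by
  \<open>between_connected_saturated\<close>. A graph with all degrees \<open>2\<close> is not properly contained in another one.
\<close>

lemma stable_multi_matching_exists_unique:
  fixes V :: "real set"
  assumes fin: "\<And>a b. finite (V \<inter> {a..b})"
    and c: "incseq c" "filterlim c at_top sequentially"
    and ties: "\<And>n. no_ties {- c n..c n} (V \<inter> {- c n..c n})"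
    and good: "eventually (\<lambda>n. good_interval V (- c n) (c n)) sequentially"
  shows "\<exists>!E. is_stable_multi_matching V E"
proof -
  define K where "K n = core_on V (- c n) (c n)" for n :: nat
  have Kmono: "K m \<subseteq> K n" if "m \<le> n" for m n
    unfolding K_def by (rule core_on_mono[OF fin ties]) (use c(1) that in \<open>auto simp: incseq_def\<close>)
  have K: "greedy_line (V \<inter> {- c n..c n}) (K n)" for n
    unfolding K_def greedy_line_def by (rule core_greedy[OF fin])
  define E where "E = (\<Union>n. K n)"
  have KE: "K n \<subseteq> E" for n by (auto simp: E_def)
  have three: "finite (E `` {x}) \<and> vertex_degree E x \<le> 2" for x
  proof -
    have "card T \<le> 2" if T: "T \<subseteq> E `` {x}" "finite T" for T
    proof -
      have "\<forall>y\<in>T. \<exists>n. (x, y) \<in> K n" using T(1) by (auto simp: E_def)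
      then obtain f where f: "\<And>y. y \<in> T \<Longrightarrow> (x, y) \<in> K (f y)" by metis
      obtain N where "\<forall>n\<in>f ` T. n \<le> N" using T(2) finite_nat_set_iff_bounded_le by blast
      then have "T \<subseteq> K N `` {x}" using f Kmono by blast
      then have "card T \<le> card (K N `` {x})"
        using greedy_graph.finite_nbrs K unfolding greedy_line_def by (intro card_mono) blast+
      also have "\<dots> \<le> 2"
        using greedy_graph.degree_le K unfolding greedy_line_def vertex_degree_def by blast
      finally show ?thesis .
    qed
    then show ?thesis
      unfolding vertex_degree_def by (metis card_le_if_inj_on_rel finite_if_finite_subsets_card_bdd subset_refl)
  qed
  have graph: "simple_graph V E"
  proof -
    have "simple_graph (V \<inter> {- c n..c n}) (K n)" for n
      using greedy_graph.graph K unfolding greedy_line_def by blast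
    then have *: "\<And>n. K n \<subseteq> V \<times> V" "\<And>n. sym (K n)" "\<And>n. irrefl (K n)"
      unfolding simple_graph_def by blast+
    have "sym E" unfolding E_def by (rule sym_UNION) (use * in auto)
    then show ?thesis using * unfolding simple_graph_def E_def irrefl_def by blast
  qed
  interpret greedy_line V E
  proof
    show "simple_graph V E" "finite (E `` {x})" "vertex_degree E x \<le> 2" for x
      using graph three by auto
    fix x y z
    assume a: "y \<in> V" "x \<noteq> y" "(x, y) \<notin> E" "(x, z) \<in> E" "dist x y < dist x z"
    obtain m where m: "(x, z) \<in> K m" using a(4) by (auto simp: E_def)
    have "eventually (\<lambda>n. \<bar>y\<bar> \<le> c n \<and> m \<le> n) sequentially"
      using c(2) by (intro eventually_conj eventually_ge_at_top) (simp add: filterlim_at_top)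
    then obtain n where n: "\<bar>y\<bar> \<le> c n" "m \<le> n" by (auto simp: eventually_sequentially)
    have yn: "y \<in> V \<inter> {- c n..c n}" using a(1) n(1) by auto
    have "(x, z) \<in> K n" "(x, y) \<notin> K n" using m Kmono[OF n(2)] a(3) KE by auto
    then have full: "vertex_degree (K n) y = 2" "\<And>w. (y, w) \<in> K n \<Longrightarrow> dist y w \<le> dist x y"
      using core_longer_edge[OF fin yn a(2)] a(5) unfolding K_def by fastforce+
    \<comment> \<open>\<open>y\<close> is saturated in the finite core, so its edges are already final\<close>
    have eq: "K n `` {y} = E `` {y}"
      using three[of y] KE[of n] full(1) unfolding vertex_degree_def by (intro card_seteq) auto
    then show "vertex_degree E y = 2 \<and> (\<forall>w. (y, w) \<in> E \<longrightarrow> dist y w \<le> dist x y)"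
    proof (intro conjI allI impI)
      show "vertex_degree E y = 2" using full(1) by (simp only: vertex_degree_def eq)
      show "dist y w \<le> dist x y" if "(y, w) \<in> E" for w
        by (rule full(2)) (use that eq in \<open>simp flip: Image_singleton_iff\<close>)
    qed
  qed
  have sat: "vertex_degree E x = 2" if x: "x \<in> V" for x
  proof -
    have "eventually (\<lambda>n. 2 * \<bar>x\<bar> < c n) sequentially"
      using c(2) by (simp add: filterlim_at_top_dense)
    then have "eventually (\<lambda>n. 2 * \<bar>x\<bar> < c n \<and> good_interval V (- c n) (c n)) sequentially"
      using good by (rule eventually_conj)
    then obtain n where n: "2 * \<bar>x\<bar> < c n" "good_interval V (- c n) (c n)"
      by (auto simp: eventually_sequentially)
    then obtain p q where "p \<le> - c n / 2" "c n / 2 \<le> q" and pq: "(p, q) \<in> (K n)\<^sup>*"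
      unfolding good_interval_iff K_def by force
    then have "p < x" "x < q" using n(1) by auto
    moreover have "(p, q) \<in> E\<^sup>*" using pq rtrancl_mono[OF KE] by blast
    ultimately show ?thesis using between_connected_saturated x by blast
  qed
  show ?thesis
  proof (rule ex1I)
    show "is_stable_multi_matching V E"
      unfolding is_stable_multi_matching_def
    proof (intro conjI ballI impI)
      fix x y assume xy: "x \<in> V" "y \<in> V" "x \<noteq> y"
      show "(x, y) \<in> E \<or> (\<forall>z. (x, z) \<in> E \<longrightarrow> dist x z \<le> dist x y) \<or> (\<forall>z. (y, z) \<in> E \<longrightarrow> dist y z \<le> dist x y)"
        using longer_edge[OF xy(2,3)] by (meson not_le)
    qed (use graph sat in auto)
  next
    fix F assume F: "is_stable_multi_matching V F"
    interpret F: greedy_graph V F by (rule stable_multi_matching_greedy[OF F])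
    have "E \<subseteq> F" unfolding E_def K_def using core_on_subset_stable[OF F] by blast
    moreover have "(x, y) \<in> E" if "(x, y) \<in> F" for x y
    proof -
      have "vertex_degree F x = 2" "vertex_degree E x = 2"
        using F sat F.edge_in[OF that] by (auto simp: is_stable_multi_matching_def)
      then have "E `` {x} = F `` {x}"
        using F.finite_nbrs[of x] \<open>E \<subseteq> F\<close> unfolding vertex_degree_def by (intro card_seteq) auto
      then show ?thesis using that by blast
    qed
    ultimately show "F = E" by auto
  qed
qed

text \<open>
  At scale \<open>l = 7 ^ n * L\<close> the nine intervals starting at \<open>l/2, l, \<dots>, 9 * l/2\<close> overlap by halves and
  carry a common component. The first interval of the next scale starts at \<open>7/2 * l\<close>. Its crossing component begins in
  \<open>[7/2 * l, 21/4 * l]\<close>, which is covered by the middle halves of the intervals \<open>6, \<dots>, 9\<close>, and ends beyond all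
  nine of them.
\<close>

lemma infinite_component_if_good_scales:
  fixes V :: "real set"
  assumes stable: "is_stable_multi_matching V E" and L: "L > 0"
    and good: "\<And>n k. N \<le> n \<Longrightarrow> 1 \<le> k \<Longrightarrow> k \<le> 9 \<Longrightarrow>
      good_interval V (real k * (7 ^ n * L) / 2) (real k * (7 ^ n * L) / 2 + 7 ^ n * L)"
  shows "\<exists>C \<in> graph_components V E. infinite C"
proof -
  interpret greedy_line V E
    unfolding greedy_line_def by (rule stable_multi_matching_greedy[OF stable])
  define l where "l n = 7 ^ n * L" for n :: nat
  have l: "l n > 0" "l (Suc n) = 7 * l n" for n using L by (simp_all add: l_def)
  define s where "s n k = real k * l n / 2" for n k
  have s_Suc: "s n (Suc k) = s n k + l n / 2" for n k by (simp add: s_def field_simps)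
  let ?ok = "\<lambda>n (k::nat). N \<le> n \<and> 1 \<le> k \<and> k \<le> 9"
  have "\<exists>p q. ?ok n k \<longrightarrow> p \<in> V \<and> s n k \<le> p \<and> p \<le> s n k + l n / 4 \<and> s n k + 3/4 * l n \<le> q \<and>
      (p, q) \<in> (core_on V (s n k) (s n k + l n))\<^sup>*" for n k
    using good[of n k] good_interval_crossing[of V "s n k" "l n"] unfolding s_def l_def by metis
  then obtain p q where pq: "?ok n k \<Longrightarrow> p n k \<in> V \<and> s n k \<le> p n k \<and> p n k \<le> s n k + l n / 4 \<and>
      s n k + 3/4 * l n \<le> q n k \<and> (p n k, q n k) \<in> (core_on V (s n k) (s n k + l n))\<^sup>*" for n k
    by metis
  have coreE: "core_on V a b \<subseteq> E" for a b by (rule core_on_subset_stable[OF stable])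
  have meet: "(p n k, p m j) \<in> E\<^sup>*"
    if "?ok n k" "?ok m j" "p n k \<le> p m j" "p m j \<le> q n k" "s n k + l n < q m j" for n k m j
  proof (rule crossings_meet[OF coreE _ _ _ that(3-5)])
    show "(p n k, q n k) \<in> (core_on V (s n k) (s n k + l n))\<^sup>*" using pq[OF that(1)] by blast
    show "(p m j, q m j) \<in> E\<^sup>*" using pq[OF that(2)] rtrancl_mono[OF coreE] by blast
  qed (rule core_on_edge(6))
  have same_scale: "(p n 1, p n k) \<in> E\<^sup>*" if "?ok n k" for n k
    using that
  proof (induction k)
    case (Suc k)
    show ?case
    proof (cases "k = 0")
      case False
      then have ok: "?ok n k" "?ok n (Suc k)" using Suc.prems by auto
      have "(p n k, p n (Suc k)) \<in> E\<^sup>*"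
        by (rule meet[OF ok]) (use pq[OF ok(1)] pq[OF ok(2)] s_Suc[of n k] l(1)[of n] in auto)
      then show ?thesis using Suc.IH[OF ok(1)] by (meson rtrancl_trans)
    qed simp
  qed simp
  have next_scale: "(p n 1, p (Suc n) 1) \<in> E\<^sup>*" if n: "N \<le> n" for n
  proof -
    have ok': "?ok (Suc n) 1" using n by simp
    have p': "7/2 * l n \<le> p (Suc n) 1" "p (Suc n) 1 \<le> 21/4 * l n" "35/4 * l n \<le> q (Suc n) 1"
      using pq[OF ok'] l(2)[of n] by (auto simp: s_def)
    have "\<exists>k\<in>{6, 7, 8, 9}. s n k + l n / 4 \<le> p (Suc n) 1 \<and> p (Suc n) 1 \<le> s n k + 3/4 * l n"
      using p' l(1)[of n] by (simp add: s_def) linarith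
    then obtain k where k: "k \<in> {6, 7, 8, 9}" "s n k + l n / 4 \<le> p (Suc n) 1" "p (Suc n) 1 \<le> s n k + 3/4 * l n"
      by blast
    have ok: "?ok n k" using k(1) n by auto
    have "real k * l n \<le> 9 * l n" using ok l(1)[of n] by (intro mult_right_mono) auto
    then have "s n k + l n < q (Suc n) 1" using p'(3) l(1)[of n] unfolding s_def by linarith
    then have "(p n k, p (Suc n) 1) \<in> E\<^sup>*"
      by (intro meet[OF ok ok']) (use pq[OF ok] k in auto)
    then show ?thesis using same_scale[OF ok] by (meson rtrancl_trans)
  qed
  have all: "(p N 1, p (N + n) 1) \<in> E\<^sup>*" for n
  proof (induction n)
    case (Suc n)
    then show ?case using next_scale[of "N + n"] by (auto intro: rtrancl_trans)
  qed simp
  let ?C = "{y \<in> V. (p N 1, y) \<in> E\<^sup>*}"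
  have "?C \<in> graph_components V E"
    using pq[of N 1] unfolding graph_components_def by (intro CollectI exI[of _ "p N 1"] conjI refl) auto
  moreover have "infinite ?C"
  proof
    assume "finite ?C"
    then obtain b where b: "\<And>y. y \<in> ?C \<Longrightarrow> y \<le> b"
      using bdd_above_finite unfolding bdd_above_def by blast
    obtain n where n: "2 * b / L < 7 ^ n" using real_arch_pow[of 7 "2 * b / L"] by auto
    then have "2 * b < 7 ^ n * L" using L by (simp add: field_simps)
    also have "\<dots> \<le> 7 ^ (N + n) * L" using L by (intro mult_right_mono power_increasing) auto
    finally have "b < s (N + n) 1" by (simp add: s_def l_def)
    then have "b < p (N + n) 1" using pq[of "N + n" 1] by simp
    moreover have "p (N + n) 1 \<in> ?C" using all[of n] pq[of "N + n" 1] by simp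
    ultimately show False using b by fastforce
  qed
  ultimately show ?thesis by blast
qed

section \<open>Configurations in the same order of distances\<close>

lemma in_edge_image:
  assumes "inj_on f P" "E \<subseteq> P \<times> P" "x \<in> P" "y \<in> P"
  shows "(f x, f y) \<in> map_prod f f ` E \<longleftrightarrow> (x, y) \<in> E"
proof
  assume "(f x, f y) \<in> map_prod f f ` E"
  then obtain s t where st: "(s, t) \<in> E" "f s = f x" "f t = f y" by auto
  then have "s = x" "t = y" using assms by (auto dest: inj_onD)
  then show "(x, y) \<in> E" using st by simp
next
  assume "(x, y) \<in> E"
  then have "map_prod f f (x, y) \<in> map_prod f f ` E" by (rule imageI)
  then show "(f x, f y) \<in> map_prod f f ` E" by simp
qed

lemma vertex_degree_image:
  assumes "inj_on f P" "E \<subseteq> P \<times> P" "x \<in> P"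
  shows "vertex_degree (map_prod f f ` E) (f x) = vertex_degree E x"
proof -
  have "(map_prod f f ` E) `` {f x} = f ` (E `` {x})"
  proof (intro set_eqI iffI)
    fix z assume "z \<in> (map_prod f f ` E) `` {f x}"
    then obtain s t where st: "(s, t) \<in> E" "f s = f x" "z = f t" by auto
    then have "s = x" using assms by (auto dest: inj_onD)
    then show "z \<in> f ` (E `` {x})" using st by auto
  next
    fix z assume "z \<in> f ` (E `` {x})"
    then obtain t where "(x, t) \<in> E" "z = f t" by auto
    then show "z \<in> (map_prod f f ` E) `` {f x}" by force
  qed
  moreover have "inj_on f (E `` {x})" using assms by (auto intro: inj_on_subset)
  ultimately show ?thesis by (simp add: vertex_degree_def card_image)
qed

lemma connected_image:
  assumes "inj_on f P" "E \<subseteq> P \<times> P" "x \<in> P" "y \<in> P"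
  shows "(f x, f y) \<in> (map_prod f f ` E)\<^sup>* \<longleftrightarrow> (x, y) \<in> E\<^sup>*"
proof
  have "\<exists>w\<in>P. z = f w \<and> (x, w) \<in> E\<^sup>*" if "(f x, z) \<in> (map_prod f f ` E)\<^sup>*" for z
    using that
  proof (induction rule: rtrancl_induct)
    case base
    show ?case using assms(3) by blast
  next
    case (step y z)
    then obtain w s t where w: "w \<in> P" "y = f w" "(x, w) \<in> E\<^sup>*" and st: "(s, t) \<in> E" "f s = y" "z = f t"
      by auto
    then have "s = w" using assms by (auto dest: inj_onD)
    then have "(x, t) \<in> E\<^sup>*" using w(3) st(1) by simp
    then show ?case using st assms(2) by blast
  qed
  then show "(x, y) \<in> E\<^sup>*" if "(f x, f y) \<in> (map_prod f f ` E)\<^sup>*"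
    using that assms by (metis inj_onD)
next
  assume "(x, y) \<in> E\<^sup>*"
  then show "(f x, f y) \<in> (map_prod f f ` E)\<^sup>*"
  proof (induction rule: rtrancl_induct)
    case (step y z)
    have "map_prod f f (y, z) \<in> map_prod f f ` E" using step(2) by (rule imageI)
    then show ?case using step(3) by (simp add: rtrancl_into_rtrancl)
  qed simp
qed

lemma stage_in: "stage S P n \<subseteq> P \<times> P"
  using stage_graph(1)[where P = P and S = S and n = n] by (simp add: simple_graph_def)

lemma core_in: "core S P \<subseteq> P \<times> P"
  using stage_in unfolding core_multi_matching_def by blast

text \<open>
  The core algorithm only compares distances from one point, so it commutes with every injection that
  preserves the outcome of these comparisons.
\<close>

lemma core_image:
  assumes inj: "inj_on f P"
    and cmp: "\<And>x t u. x \<in> P \<Longrightarrow> t \<in> insert None (Some ` (P - {x})) \<Longrightarrow> u \<in> insert None (Some ` (P - {x})) \<Longrightarrow>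
      core_dist S' (f x) (map_option f t) < core_dist S' (f x) (map_option f u) \<longleftrightarrow>
      core_dist S x t < core_dist S x u"
  shows "core S' (f ` P) = map_prod f f ` core S P"
proof -
  have dist_cmp: "dist (f x) (f y) < dist (f x) (f z) \<longleftrightarrow> dist x y < dist x z"
    if "x \<in> P" "y \<in> P" "y \<noteq> x" "z \<in> P" "z \<noteq> x" for x y z
    using cmp[of x "Some y" "Some z"] that by simp
  have bdry_cmp: "dist (f x) (f y) < infdist (f x) (- S') \<longleftrightarrow> dist x y < infdist x (- S)"
    if "x \<in> P" "y \<in> P" "y \<noteq> x" for x y
    using cmp[of x "Some y" None] that by simp
  have f_eq: "f x = f y \<longleftrightarrow> x = y" if "x \<in> P" "y \<in> P" for x y
    using inj that by (auto dest: inj_onD)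
  have arrow: "arrow S' (f ` P) (map_prod f f ` E) (f x) (f y) \<longleftrightarrow> arrow S P E x y"
    if E: "E \<subseteq> P \<times> P" and xy: "x \<in> P" "y \<in> P" for E x y
  proof (cases "x = y")
    case False
    have "(\<forall>u\<in>f ` P. u \<noteq> f x \<longrightarrow> vertex_degree (map_prod f f ` E) u < 2 \<longrightarrow>
          (f x, u) \<notin> map_prod f f ` E \<longrightarrow> u \<noteq> f y \<longrightarrow> dist (f x) (f y) < dist (f x) u) \<longleftrightarrow>
        (\<forall>u\<in>P. u \<noteq> x \<longrightarrow> vertex_degree E u < 2 \<longrightarrow> (x, u) \<notin> E \<longrightarrow> u \<noteq> y \<longrightarrow> dist x y < dist x u)"
      unfolding Set.ball_simps(9)
      by (intro ball_cong refl)
        (use xy False in \<open>simp add: f_eq in_edge_image[OF inj E] vertex_degree_image[OF inj E] dist_cmp\<close>)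
    then show ?thesis
      unfolding arrow_iff using xy False
      by (simp add: f_eq in_edge_image[OF inj E] vertex_degree_image[OF inj E] bdry_cmp)
  qed (simp add: arrow_iff)
  have "stage S' (f ` P) n = map_prod f f ` stage S P n" for n
  proof (induction n)
    case (Suc n)
    let ?E = "stage S P n"
    have "{(x, y). arrow S' (f ` P) (map_prod f f ` ?E) x y \<and> arrow S' (f ` P) (map_prod f f ` ?E) y x} =
        map_prod f f ` {(x, y). arrow S P ?E x y \<and> arrow S P ?E y x}" (is "?L = ?R")
    proof (intro set_eqI iffI)
      fix e assume "e \<in> ?L"
      then obtain x y where e: "e = (f x, f y)" "x \<in> P" "y \<in> P"
        "arrow S' (f ` P) (map_prod f f ` ?E) (f x) (f y)" "arrow S' (f ` P) (map_prod f f ` ?E) (f y) (f x)"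
        using arrowD(1) by (cases e) blast
      then have "(x, y) \<in> {(x, y). arrow S P ?E x y \<and> arrow S P ?E y x}"
        using arrow[OF stage_in] by simp
      then have "map_prod f f (x, y) \<in> ?R" by (rule imageI)
      then show "e \<in> ?R" using e(1) by simp
    next
      fix e assume "e \<in> ?R"
      then obtain x y where e: "e = (f x, f y)" "arrow S P ?E x y" "arrow S P ?E y x" by auto
      then have "x \<in> P" "y \<in> P" using arrowD(1) by blast+
      then show "e \<in> ?L" using arrow[OF stage_in] e by auto
    qed
    then show ?case unfolding stage_Suc Suc.IH by (simp add: image_Un)
  qed simp
  then show ?thesis by (simp add: core_multi_matching_def image_UN)
qed

lemma good_interval_image:
  assumes V': "V' \<inter> {a'..b'} = f ` (V \<inter> {a..b})" and inj: "inj_on f (V \<inter> {a..b})"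
    and cmp: "\<And>x t u. x \<in> V \<inter> {a..b} \<Longrightarrow> t \<in> insert None (Some ` (V \<inter> {a..b} - {x})) \<Longrightarrow>
      u \<in> insert None (Some ` (V \<inter> {a..b} - {x})) \<Longrightarrow>
      core_dist {a'..b'} (f x) (map_option f t) < core_dist {a'..b'} (f x) (map_option f u) \<longleftrightarrow>
      core_dist {a..b} x t < core_dist {a..b} x u"
    and first: "\<And>x. x \<in> V \<inter> {a..b} \<Longrightarrow> f x \<le> 3/4 * a' + 1/4 * b' \<longleftrightarrow> x \<le> 3/4 * a + 1/4 * b"
    and last: "\<And>x. x \<in> V \<inter> {a..b} \<Longrightarrow> 1/4 * a' + 3/4 * b' \<le> f x \<longleftrightarrow> 1/4 * a + 3/4 * b \<le> x"
  shows "good_interval V' a' b' \<longleftrightarrow> good_interval V a b"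
proof -
  have "core_on V' a' b' = map_prod f f ` core_on V a b"
    unfolding V' by (rule core_image[OF inj cmp])
  then have "(f p, f q) \<in> (core_on V' a' b')\<^sup>* \<longleftrightarrow> (p, q) \<in> (core_on V a b)\<^sup>*"
    if "p \<in> V \<inter> {a..b}" "q \<in> V \<inter> {a..b}" for p q
    using connected_image[OF inj core_in that] by simp
  then show ?thesis
    unfolding good_interval_iff V' Set.bex_simps(7)
    using first last by (intro bex_cong refl) simp
qed

lemma good_interval_translate:
  "good_interval ((\<lambda>x. x + c) ` V) (a + c) (b + c) \<longleftrightarrow> good_interval V a b"
proof (rule good_interval_image)
  show "(\<lambda>x. x + c) ` V \<inter> {a + c..b + c} = (\<lambda>x. x + c) ` (V \<inter> {a..b})" by auto
  fix x t u
  assume "x \<in> V \<inter> {a..b}"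
  then have "core_dist {a + c..b + c} (x + c) (map_option (\<lambda>x. x + c) t) = core_dist {a..b} x t" for t
    by (cases t) (auto simp: infdist_interval dist_real_def)
  then show "core_dist {a + c..b + c} (x + c) (map_option (\<lambda>x. x + c) t)
      < core_dist {a + c..b + c} (x + c) (map_option (\<lambda>x. x + c) u) \<longleftrightarrow>
      core_dist {a..b} x t < core_dist {a..b} x u" by simp
qed (auto simp: field_simps)

section \<open>Approximation by occupied grid cells\<close>

definition cell :: "real \<Rightarrow> real \<Rightarrow> nat \<Rightarrow> real set" where
  "cell a h i = {a + real i * h..<a + (real i + 1) * h}"

text \<open>
  The indices refer to the \<open>2 ^ m\<close> half-open cells that partition \<open>{a..<a + l}\<close>.
\<close>

definition occupied_cells :: "real set \<Rightarrow> real \<Rightarrow> real \<Rightarrow> nat \<Rightarrow> nat set" where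
  "occupied_cells V a l m = {i. i < 2 ^ m \<and> V \<inter> cell a (l / 2 ^ m) i \<noteq> {}}"

definition grid_points :: "real \<Rightarrow> real \<Rightarrow> nat \<Rightarrow> nat set \<Rightarrow> real set" where
  "grid_points a l m T = (\<lambda>i. a + real i * (l / 2 ^ m)) ` T"

lemma mem_cell_iff: "h > 0 \<Longrightarrow> x \<in> cell a h i \<longleftrightarrow> \<lfloor>(x - a) / h\<rfloor> = int i"
  by (auto simp: cell_def floor_eq_iff field_simps)

lemma cell_props: "bounded (cell a h i)" "cell a h i \<in> sets borel" "h > 0 \<Longrightarrow> measure lborel (cell a h i) = h"
  by (auto simp: cell_def algebra_simps)

lemma cell_disjoint: "h > 0 \<Longrightarrow> i \<noteq> j \<Longrightarrow> cell a h i \<inter> cell a h j = {}"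
  using mem_cell_iff[of h] by auto

lemma cell_cover:
  assumes "l > 0" "a \<le> x" "x < a + l"
  obtains i where "i < 2 ^ m" "x \<in> cell a (l / 2 ^ m) i"
proof -
  define h where "h = l / 2 ^ m"
  have h: "h > 0" "2 ^ m * h = l" using assms(1) by (simp_all add: h_def)
  define i where "i = nat \<lfloor>(x - a) / h\<rfloor>"
  have i: "int i = \<lfloor>(x - a) / h\<rfloor>" using assms h by (simp add: i_def)
  have "(x - a) / h < 2 ^ m" using assms h by (simp add: pos_divide_less_eq)
  then have "of_int (int i) < (2 ^ m :: real)" unfolding i by linarith
  then have "real i < real (2 ^ m)" by simp
  then have "i < 2 ^ m" by (simp only: of_nat_less_iff)
  moreover have "x \<in> cell a h i" using mem_cell_iff[OF h(1)] i by simp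
  ultimately show thesis using that unfolding h_def by blast
qed

lemma cell_subset:
  assumes "l > 0" "i < 2 ^ m"
  shows "cell a (l / 2 ^ m) i \<subseteq> {a..<a + l}"
proof
  fix x assume x: "x \<in> cell a (l / 2 ^ m) i"
  have "real (Suc i) \<le> real (2 ^ m)" using assms(2) by (simp only: of_nat_le_iff Suc_leI)
  then have "(real i + 1) * (l / 2 ^ m) \<le> 2 ^ m * (l / 2 ^ m)"
    using assms(1) by (intro mult_right_mono) simp_all
  moreover have "0 \<le> real i * (l / 2 ^ m)" using assms(1) by simp
  ultimately show "x \<in> {a..<a + l}" using x by (auto simp: cell_def)
qed

lemma eventually_less_iff:
  fixes g h :: "nat \<Rightarrow> real"
  assumes "g \<longlonglongrightarrow> A" "h \<longlonglongrightarrow> B" "A \<noteq> B"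
  shows "eventually (\<lambda>m. g m < h m \<longleftrightarrow> A < B) sequentially"
proof -
  have "eventually (\<lambda>m. g m < h m) sequentially" if "A < B" "g \<longlonglongrightarrow> A" "h \<longlonglongrightarrow> B" for g h :: "nat \<Rightarrow> real" and A B
  proof -
    have "eventually (\<lambda>m. g m < (A + B) / 2) sequentially" "eventually (\<lambda>m. (A + B) / 2 < h m) sequentially"
      using that order_tendstoD(2)[of g A _ "(A + B) / 2"] order_tendstoD(1)[of h B _ "(A + B) / 2"] by auto
    then show ?thesis by eventually_elim simp
  qed
  note lt = this
  show ?thesis
  proof (cases "A < B")
    case True
    then show ?thesis using lt[OF True assms(1,2)] by simp
  next
    case False
    then have "eventually (\<lambda>m. h m < g m) sequentially" using lt[of B A h g] assms by simp
    then show ?thesis by eventually_elim (use False in simp)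
  qed
qed

text \<open>
  Moving each point to the left end of its cell shifts it by at most \<open>l / 2 ^ m\<close>. This preserves the
  finitely many strict comparisons of distances once \<open>m\<close> is large. Moving to the left never carries a
  point out of the closed first quarter, and the start of the last quarter is itself a grid point
  as soon as \<open>2 \<le> m\<close>.
\<close>

lemma good_interval_grid_approximation:
  fixes V :: "real set" and a l :: real
  assumes fin: "finite (V \<inter> {a..a + l})" and ties: "no_ties {a..a + l} (V \<inter> {a..a + l})"
    and l: "l > 0" and right: "a + l \<notin> V"
  shows "eventually (\<lambda>m. good_interval (grid_points a l m (occupied_cells V a l m)) a (a + l) \<longleftrightarrow>
           good_interval V a (a + l)) sequentially"
proof -
  let ?P = "V \<inter> {a..a + l}" and ?S = "{a..a + l}"
  define h where "h m = l / 2 ^ m" for m :: nat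
  have h: "h m > 0" for m using l by (simp add: h_def)
  define f where "f m x = a + of_int \<lfloor>(x - a) / h m\<rfloor> * h m" for m x
  have f_le: "f m x \<le> x" and f_ge: "x - h m \<le> f m x" for m x
  proof -
    have "of_int \<lfloor>(x - a) / h m\<rfloor> \<le> (x - a) / h m" "(x - a) / h m \<le> of_int \<lfloor>(x - a) / h m\<rfloor> + 1"
      by linarith+
    then have "of_int \<lfloor>(x - a) / h m\<rfloor> * h m \<le> x - a" "x - a \<le> (of_int \<lfloor>(x - a) / h m\<rfloor> + 1) * h m"
      using h[of m] by (simp_all only: pos_le_divide_eq pos_divide_le_eq)
    then show "f m x \<le> x" "x - h m \<le> f m x" by (auto simp: f_def algebra_simps)
  qed
  have h0: "h \<longlonglongrightarrow> 0" unfolding h_def by (intro LIMSEQ_divide_realpow_zero) simp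
  have f_lim: "(\<lambda>m. f m x) \<longlonglongrightarrow> x" for x
  proof (rule tendsto_sandwich)
    show "(\<lambda>m. x - h m) \<longlonglongrightarrow> x" using tendsto_diff[OF tendsto_const h0, of x] by simp
  qed (use f_le f_ge in auto)
  have grid: "grid_points a l m (occupied_cells V a l m) \<inter> ?S = f m ` ?P" for m
  proof (intro set_eqI iffI)
    fix z assume "z \<in> grid_points a l m (occupied_cells V a l m) \<inter> ?S"
    then obtain i x where ix: "i < 2 ^ m" "z = a + real i * h m" "x \<in> V" "x \<in> cell a (h m) i"
      by (auto simp: grid_points_def occupied_cells_def h_def)
    then have "\<lfloor>(x - a) / h m\<rfloor> = int i" using mem_cell_iff[OF h] by blast
    then have "z = f m x" using ix(2) by (simp add: f_def)
    moreover have "x \<in> ?S" using cell_subset[OF l ix(1), of a] ix(4) by (auto simp: h_def)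
    ultimately show "z \<in> f m ` ?P" using ix(3) by blast
  next
    fix z assume "z \<in> f m ` ?P"
    then obtain x where x: "x \<in> V" "a \<le> x" "x \<le> a + l" "z = f m x" by auto
    then have "x < a + l" using right by (auto simp: le_less)
    obtain i where i: "i < 2 ^ m" "x \<in> cell a (h m) i"
      using cell_cover[OF l x(2) \<open>x < a + l\<close>] unfolding h_def by blast
    then have "i \<in> occupied_cells V a l m" using x(1) by (auto simp: occupied_cells_def h_def)
    moreover have "\<lfloor>(x - a) / h m\<rfloor> = int i" using mem_cell_iff[OF h] i(2) by blast
    then have z: "z = a + real i * (l / 2 ^ m)" by (simp add: x(4) f_def h_def)
    moreover have "a \<le> z" using z l by simp
    ultimately show "z \<in> grid_points a l m (occupied_cells V a l m) \<inter> ?S"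
      using f_le[of m x] x by (auto simp: grid_points_def)
  qed
  have ev_inj: "eventually (\<lambda>m. inj_on (f m) ?P) sequentially"
  proof -
    have "eventually (\<lambda>m. x \<noteq> y \<longrightarrow> f m x \<noteq> f m y) sequentially" for x y
    proof (cases "x = y")
      case False
      have "eventually (\<lambda>m. f m x < f m y \<longleftrightarrow> x < y) sequentially"
        "eventually (\<lambda>m. f m y < f m x \<longleftrightarrow> y < x) sequentially"
        using False by (auto intro: eventually_less_iff[OF f_lim f_lim])
      then show ?thesis by eventually_elim (use False in auto)
    qed simp
    then have "eventually (\<lambda>m. \<forall>x\<in>?P. \<forall>y\<in>?P. x \<noteq> y \<longrightarrow> f m x \<noteq> f m y) sequentially"
      using fin by (intro eventually_ball_finite ballI) auto
    then show ?thesis by (rule eventually_mono) (auto simp: inj_on_def)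
  qed
  have ev_cmp: "eventually (\<lambda>m. \<forall>x\<in>?P. \<forall>t\<in>insert None (Some ` (?P - {x})). \<forall>u\<in>insert None (Some ` (?P - {x})).
      core_dist ?S (f m x) (map_option (f m) t) < core_dist ?S (f m x) (map_option (f m) u) \<longleftrightarrow>
      core_dist ?S x t < core_dist ?S x u) sequentially"
  proof (intro eventually_ball_finite ballI)
    fix x t u
    assume x: "x \<in> ?P" and tu: "t \<in> insert None (Some ` (?P - {x}))" "u \<in> insert None (Some ` (?P - {x}))"
    have lim: "(\<lambda>m. core_dist ?S (f m x) (map_option (f m) t)) \<longlonglongrightarrow> core_dist ?S x t" for t
      by (cases t) (auto intro!: tendsto_intros f_lim)
    show "eventually (\<lambda>m. core_dist ?S (f m x) (map_option (f m) t) < core_dist ?S (f m x) (map_option (f m) u) \<longleftrightarrow>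
      core_dist ?S x t < core_dist ?S x u) sequentially"
    proof (cases "t = u")
      case False
      have "inj_on (core_dist ?S x) (insert None (Some ` (?P - {x})))" using ties x by (simp add: no_ties_def)
      then have "core_dist ?S x t \<noteq> core_dist ?S x u" using tu False by (meson inj_onD)
      then show ?thesis using lim by (intro eventually_less_iff)
    qed simp
  qed (use fin in auto)
  have ev_first: "eventually (\<lambda>m. \<forall>x\<in>?P. f m x \<le> 3/4 * a + 1/4 * (a + l) \<longleftrightarrow> x \<le> 3/4 * a + 1/4 * (a + l)) sequentially"
  proof (intro eventually_ball_finite ballI fin)
    fix x
    let ?c = "3/4 * a + 1/4 * (a + l)"
    show "eventually (\<lambda>m. f m x \<le> ?c \<longleftrightarrow> x \<le> ?c) sequentially"
    proof (cases "x \<le> ?c")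
      case True
      then show ?thesis using f_le order_trans by (intro always_eventually allI) blast
    next
      case False
      then have "eventually (\<lambda>m. ?c < f m x) sequentially" by (intro order_tendstoD(1)[OF f_lim]) simp
      then show ?thesis by eventually_elim (use False in simp)
    qed
  qed
  have last: "1/4 * a + 3/4 * (a + l) \<le> f m x \<longleftrightarrow> 1/4 * a + 3/4 * (a + l) \<le> x" if m: "2 \<le> m" for m x
  proof -
    obtain k where k: "m = k + 2" using m by (metis add.commute le_Suc_ex)
    have c: "1/4 * a + 3/4 * (a + l) = a + of_int (3 * 2 ^ k) * h m"
      by (simp add: h_def k power_add field_simps)
    have "a + of_int (3 * 2 ^ k) * h m \<le> f m x \<longleftrightarrow> of_int (3 * 2 ^ k) \<le> (of_int \<lfloor>(x - a) / h m\<rfloor> :: real)"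
      using h[of m] unfolding f_def by simp
    also have "\<dots> \<longleftrightarrow> 3 * 2 ^ k \<le> \<lfloor>(x - a) / h m\<rfloor>" by (simp only: of_int_le_iff)
    also have "\<dots> \<longleftrightarrow> of_int (3 * 2 ^ k) \<le> (x - a) / h m" by (simp only: le_floor_iff)
    also have "\<dots> \<longleftrightarrow> a + of_int (3 * 2 ^ k) * h m \<le> x" using h[of m] by (auto simp: field_simps)
    finally show ?thesis unfolding c .
  qed
  show ?thesis
    using ev_inj ev_cmp ev_first eventually_ge_at_top[of 2]
  proof eventually_elim
    case (elim m)
    show ?case
      by (rule good_interval_image[OF grid elim(1)]) (use elim(2,3) last[OF elim(4)] in blast)+
  qed
qed

section \<open>Occupied and vacant sets of a Poisson process\<close>

locale unit_poisson_line = homogeneous_poisson_process M 1 X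
  for M :: "'w measure" and X :: "'w \<Rightarrow> real set"
begin

lemma finite_points: "\<omega> \<in> space M \<Longrightarrow> finite (X \<omega> \<inter> {a..b})"
  by (rule locally_finite) auto

definition occupied :: "real set \<Rightarrow> 'w set" where
  "occupied B = {\<omega> \<in> space M. X \<omega> \<inter> B \<noteq> {}}"

lemma vacant_eq:
  assumes "bounded B"
  shows "space M - occupied B = (\<lambda>\<omega>. card (X \<omega> \<inter> B)) -` {0} \<inter> space M"
  using locally_finite[OF _ assms] by (auto simp: occupied_def card_eq_0_iff)

lemma occupied_eq:
  assumes "bounded B"
  shows "occupied B = (\<lambda>\<omega>. card (X \<omega> \<inter> B)) -` (- {0}) \<inter> space M"
  using locally_finite[OF _ assms] by (auto simp: occupied_def card_eq_0_iff)

lemma occupied_event: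
  assumes "bounded B" "B \<in> sets borel"
  shows "occupied B \<in> events"
  unfolding occupied_eq[OF assms(1)] by (rule measurable_sets[OF count_measurable[OF assms]]) simp

lemma prob_vacant:
  assumes "bounded B" "B \<in> sets borel"
  shows "prob (space M - occupied B) = exp (- measure lborel B)"
proof -
  have "space M - occupied B = {\<omega> \<in> space M. card (X \<omega> \<inter> B) = 0}"
    unfolding vacant_eq[OF assms(1)] by auto
  then show ?thesis using count_poisson[OF assms, of 0] by simp
qed

lemma prob_occupied:
  assumes "bounded B" "B \<in> sets borel"
  shows "prob (occupied B) = 1 - exp (- measure lborel B)"
  using prob_vacant[OF assms] prob_compl[OF occupied_event[OF assms]] by simp

text \<open>
  A set is vacant if its count is zero, so a pattern is an intersection of independent events of known
  probability.
\<close>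

lemma prob_occupation_pattern:
  fixes n :: nat
  assumes A: "\<And>i. i < n \<Longrightarrow> bounded (A i) \<and> A i \<in> sets borel" and disj: "disjoint_family_on A {..<n}"
  shows "{\<omega> \<in> space M. \<forall>i<n. X \<omega> \<inter> A i \<noteq> {} \<longleftrightarrow> i \<in> S} \<in> events" (is "?E \<in> _")
    and "prob {\<omega> \<in> space M. \<forall>i<n. X \<omega> \<inter> A i \<noteq> {} \<longleftrightarrow> i \<in> S} =
      (\<Prod>i<n. if i \<in> S then 1 - exp (- measure lborel (A i)) else exp (- measure lborel (A i)))"
proof -
  define Y where "Y i = (if i \<in> S then - {0::nat} else {0})" for i
  let ?N = "\<lambda>i \<omega>. card (X \<omega> \<inter> A i)"
  have Y: "?N i -` Y i \<inter> space M = (if i \<in> S then occupied (A i) else space M - occupied (A i))"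
    if "i < n" for i
    using vacant_eq occupied_eq A[OF that] by (simp add: Y_def)
  have main: "?E \<in> events \<and> prob ?E = (\<Prod>i<n. prob (?N i -` Y i \<inter> space M))"
  proof (cases "n = 0")
    case False
    have "?E = (\<Inter>i\<in>{..<n}. ?N i -` Y i \<inter> space M)"
    proof -
      have "\<omega> \<in> ?N i -` Y i \<inter> space M \<longleftrightarrow> \<omega> \<in> space M \<and> (X \<omega> \<inter> A i \<noteq> {} \<longleftrightarrow> i \<in> S)" if "i < n" for i \<omega>
        unfolding Y[OF that] by (auto simp: occupied_def)
      then have "\<omega> \<in> (\<Inter>i\<in>{..<n}. ?N i -` Y i \<inter> space M) \<longleftrightarrow>
          (\<forall>i<n. \<omega> \<in> space M \<and> (X \<omega> \<inter> A i \<noteq> {} \<longleftrightarrow> i \<in> S))" for \<omega>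
        unfolding INT_iff by (metis lessThan_iff)
      then show ?thesis using False by (intro set_eqI) auto
    qed
    moreover have "?N i -` Y i \<inter> space M \<in> events" if "i < n" for i
      using Y[OF that] occupied_event A[OF that] by auto
    then have "(\<Inter>i\<in>{..<n}. ?N i -` Y i \<inter> space M) \<in> events"
      using False by (intro sets.finite_INT) auto
    moreover have "prob (\<Inter>i\<in>{..<n}. ?N i -` Y i \<inter> space M) = (\<Prod>i<n. prob (?N i -` Y i \<inter> space M))"
      using False by (intro indep_varsD[OF count_indep[OF A disj]]) auto
    ultimately show ?thesis by simp
  qed (simp add: prob_space)
  then show "?E \<in> events" by (rule conjunct1)
  have "prob (?N i -` Y i \<inter> space M) =
      (if i \<in> S then 1 - exp (- measure lborel (A i)) else exp (- measure lborel (A i)))" if "i < n" for i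
    using Y[OF that] prob_vacant prob_occupied A[OF that] by simp
  then have "(\<Prod>i<n. prob (?N i -` Y i \<inter> space M)) =
      (\<Prod>i<n. if i \<in> S then 1 - exp (- measure lborel (A i)) else exp (- measure lborel (A i)))"
    by (intro prod.cong refl) (simp only: lessThan_iff)
  then show "prob ?E =
      (\<Prod>i<n. if i \<in> S then 1 - exp (- measure lborel (A i)) else exp (- measure lborel (A i)))"
    by (rule trans[OF conjunct2[OF main]])
qed

lemma prob_all_occupied_le:
  fixes n :: nat
  assumes A: "\<And>i. i < n \<Longrightarrow> bounded (A i) \<and> A i \<in> sets borel" and disj: "disjoint_family_on A {..<n}"
  shows "prob {\<omega> \<in> space M. \<forall>i<n. X \<omega> \<inter> A i \<noteq> {}} \<le> (\<Prod>i<n. measure lborel (A i))"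
proof -
  have "prob {\<omega> \<in> space M. \<forall>i<n. X \<omega> \<inter> A i \<noteq> {}} = (\<Prod>i<n. 1 - exp (- measure lborel (A i)))"
    using prob_occupation_pattern(2)[OF A disj, of UNIV] by simp
  also have "\<dots> \<le> (\<Prod>i<n. measure lborel (A i))"
    using exp_ge_add_one_self[of "- measure lborel (A i)" for i]
    by (intro prod_mono) (auto simp: algebra_simps)
  finally show ?thesis .
qed

lemma all_occupied_event:
  fixes n :: nat
  assumes A: "\<And>i. i < n \<Longrightarrow> bounded (A i) \<and> A i \<in> sets borel" and disj: "disjoint_family_on A {..<n}"
  shows "{\<omega> \<in> space M. \<forall>i<n. X \<omega> \<inter> A i \<noteq> {}} \<in> events"
  using prob_occupation_pattern(1)[OF A disj, of UNIV] by (simp only: UNIV_I simp_thms)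

section \<open>Coincidences between distances are null\<close>

text \<open>
  The exceptional set need not be an event; it is enough to cover it by events of summable probabilities.
\<close>

lemma AE_not_if_covered:
  assumes fin: "\<And>m. finite (I m)" and ev: "\<And>m i. i \<in> I m \<Longrightarrow> F m i \<in> events"
    and bound: "\<And>m i. i \<in> I m \<Longrightarrow> prob (F m i) \<le> e m" "\<And>m. real (card (I m)) * e m \<le> K * (1/2) ^ m"
    and cover: "\<And>m \<omega>. \<omega> \<in> space M \<Longrightarrow> P \<omega> \<Longrightarrow> \<exists>i\<in>I m. \<omega> \<in> F m i"
  shows "AE \<omega> in M. \<not> P \<omega>"
proof -
  define U where "U m = (\<Union>i\<in>I m. F m i)" for m
  have U: "U m \<in> events" for m unfolding U_def using fin ev by (intro sets.finite_UN) auto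
  have le: "prob (U m) \<le> K * (1/2) ^ m" for m
  proof -
    have "prob (U m) \<le> (\<Sum>i\<in>I m. prob (F m i))"
      unfolding U_def using fin ev by (intro finite_measure_subadditive_finite) auto
    also have "\<dots> \<le> real (card (I m)) * e m" using bound(1) by (rule sum_bounded_above)
    finally show ?thesis using bound(2)[of m] by simp
  qed
  have "summable (\<lambda>m. K * (1/2) ^ m)" by (intro summable_mult summable_geometric) simp
  then have "summable (\<lambda>m. prob (U m))"
    by (rule summable_comparison_test'[where N = 0]) (simp add: le)
  then have "AE \<omega> in M. eventually (\<lambda>m. \<omega> \<in> space M - U m) sequentially"
    using U by (intro borel_cantelli_AE1) (auto simp: emeasure_eq_measure)
  then show ?thesis
  proof (eventually_elim)
    case (elim \<omega>)
    then obtain m where "\<omega> \<in> space M - U m" by (auto simp: eventually_sequentially)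
    then show ?case using cover[of \<omega> m] by (auto simp: U_def)
  qed
qed

lemma AE_no_point: "AE \<omega> in M. c \<notin> X \<omega>"
proof -
  have "prob (occupied {c}) = 0" using prob_occupied[of "{c}"] by simp
  moreover have "occupied {c} \<in> events" by (rule occupied_event) auto
  ultimately have "AE \<omega> in M. \<omega> \<notin> occupied {c}" by (simp add: prob_eq_0)
  with AE_space show ?thesis by eventually_elim (auto simp: occupied_def)
qed

text \<open>
  For a cell of length \<open>h\<close> containing \<open>x\<close>, the reflected point \<open>2 * x - c\<close> is confined to an interval of length
  \<open>2 * h\<close>. Both sets are occupied with probability at most \<open>2 * h\<^sup>2\<close>, and there are \<open>l / h\<close> cells.
\<close>

lemma AE_no_reflected_pair_in:
  assumes l: "l > 0" and disj: "{a..<a + l} \<inter> B = {}" and B: "bounded B" "B \<in> sets borel"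
  shows "AE \<omega> in M. \<not> (\<exists>x\<in>X \<omega> \<inter> {a..<a + l}. \<exists>y\<in>X \<omega> \<inter> B. y = 2 * x - c)"
proof -
  define h where "h m = l / 2 ^ m" for m :: nat
  have h: "h m > 0" for m using l by (simp add: h_def)
  define D where "D m i = B \<inter> cell (2 * a - c) (2 * h m) i" for m i
  define A where "A m i j = (if j = 0 then cell a (h m) i else D m i)" for m i and j :: nat
  have Ap: "bounded (A m i j) \<and> A m i j \<in> sets borel" for m i j
    using cell_props B by (auto simp: A_def D_def bounded_Int)
  have Ad: "disjoint_family_on (A m i) {..<2}" if "i < 2 ^ m" for m i
    using cell_subset[OF l that, of a] disj
    by (auto simp: disjoint_family_on_def A_def D_def h_def less_2_cases_iff)
  show ?thesis
  proof (rule AE_not_if_covered[where I = "\<lambda>m. {..<2 ^ m}" and K = "2 * l\<^sup>2" and e = "\<lambda>m. h m * (2 * h m)"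
        and F = "\<lambda>m i. {\<omega> \<in> space M. \<forall>j<2. X \<omega> \<inter> A m i j \<noteq> {}}"])
    fix m i assume i: "i \<in> {..<2 ^ m :: nat}"
    show "{\<omega> \<in> space M. \<forall>j<2. X \<omega> \<inter> A m i j \<noteq> {}} \<in> events"
      using all_occupied_event[OF Ap Ad] i by blast
    have "prob {\<omega> \<in> space M. \<forall>j<2. X \<omega> \<inter> A m i j \<noteq> {}} \<le> (\<Prod>j<2. measure lborel (A m i j))"
      using prob_all_occupied_le[OF Ap Ad] i by blast
    also have "\<dots> = h m * measure lborel (D m i)"
      using h[of m] by (simp add: A_def cell_props numeral_2_eq_2)
    also have "measure lborel (D m i) \<le> 2 * h m"
    proof -
      have "measure lborel (D m i) \<le> measure lborel (cell (2 * a - c) (2 * h m) i)"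
        unfolding D_def using h[of m] B by (intro measure_mono_fmeasurable) (auto simp: cell_props cell_def fmeasurable_def)
      then show ?thesis using h[of m] by (simp add: cell_props)
    qed
    finally show "prob {\<omega> \<in> space M. \<forall>j<2. X \<omega> \<inter> A m i j \<noteq> {}} \<le> h m * (2 * h m)"
      using h[of m] by simp
  next
    fix m show "real (card {..<2 ^ m :: nat}) * (h m * (2 * h m)) \<le> 2 * l\<^sup>2 * (1/2) ^ m"
      by (simp add: h_def power2_eq_square power_divide mult.left_commute)
  next
    fix m \<omega> assume "\<exists>x\<in>X \<omega> \<inter> {a..<a + l}. \<exists>y\<in>X \<omega> \<inter> B. y = 2 * x - c" "\<omega> \<in> space M"
    then obtain x where x: "x \<in> X \<omega>" "a \<le> x" "x < a + l" "2 * x - c \<in> X \<omega>" "2 * x - c \<in> B" by auto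
    obtain i where i: "i < 2 ^ m" "x \<in> cell a (h m) i"
      using cell_cover[OF l x(2,3)] unfolding h_def by blast
    then have "2 * x - c \<in> D m i" using x(5) by (auto simp: D_def cell_def algebra_simps)
    then have "X \<omega> \<inter> A m i j \<noteq> {}" for j using i x by (auto simp: A_def)
    then show "\<exists>i\<in>{..<2 ^ m}. \<omega> \<in> {\<omega> \<in> space M. \<forall>j<2. X \<omega> \<inter> A m i j \<noteq> {}}"
      using i(1) \<open>\<omega> \<in> space M\<close> by auto
  qed auto
qed

text \<open>
  For cells of length \<open>h\<close> containing \<open>y\<close> and \<open>z\<close>, the midpoint is confined to an interval of length \<open>h\<close>. The three
  sets are occupied with probability at most \<open>h ^ 3\<close>, and there are \<open>(l / h)\<^sup>2\<close> pairs of cells.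
\<close>

lemma AE_no_midpoint_in:
  assumes l: "l > 0" and disj: "{a..<a + l} \<inter> {b..<b + l} = {}" "{a..<a + l} \<inter> B = {}" "{b..<b + l} \<inter> B = {}"
    and B: "bounded B" "B \<in> sets borel"
  shows "AE \<omega> in M. \<not> (\<exists>y\<in>X \<omega> \<inter> {a..<a + l}. \<exists>z\<in>X \<omega> \<inter> {b..<b + l}. (y + z) / 2 \<in> X \<omega> \<inter> B)"
proof -
  define h where "h m = l / 2 ^ m" for m :: nat
  have h: "h m > 0" for m using l by (simp add: h_def)
  define D where "D m e = B \<inter> cell ((a + b) / 2 + (real (fst e) + real (snd e)) * h m / 2) (h m) 0" for m and e :: "nat \<times> nat"
  define A where "A m e j = (if j = 0 then cell a (h m) (fst e) else if j = 1 then cell b (h m) (snd e) else D m e)"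
    for m e and j :: nat
  have Ap: "bounded (A m e j) \<and> A m e j \<in> sets borel" for m e j
    using cell_props B by (auto simp: A_def D_def bounded_Int)
  have Ad: "disjoint_family_on (A m e) {..<3}" if "e \<in> {..<2 ^ m} \<times> {..<2 ^ m}" for m e
  proof -
    have "cell a (h m) (fst e) \<subseteq> {a..<a + l}" "cell b (h m) (snd e) \<subseteq> {b..<b + l}"
      unfolding h_def using that by (auto intro!: cell_subset[OF l] simp: mem_Times_iff)
    moreover have "D m e \<subseteq> B" by (auto simp: D_def)
    ultimately have "cell a (h m) (fst e) \<inter> cell b (h m) (snd e) = {}"
        "cell a (h m) (fst e) \<inter> D m e = {}" "cell b (h m) (snd e) \<inter> D m e = {}"
      using disj by blast+
    then show ?thesis
      by (simp add: disjoint_family_on_def A_def numeral_3_eq_3 less_Suc_eq Int_commute all_conj_distrib Ball_def)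
  qed
  show ?thesis
  proof (rule AE_not_if_covered[where I = "\<lambda>m. {..<2 ^ m} \<times> {..<2 ^ m}" and K = "l ^ 3" and e = "\<lambda>m. h m * h m * h m"
        and F = "\<lambda>m e. {\<omega> \<in> space M. \<forall>j<3. X \<omega> \<inter> A m e j \<noteq> {}}"])
    fix m e assume e: "e \<in> {..<2 ^ m :: nat} \<times> {..<2 ^ m :: nat}"
    show "{\<omega> \<in> space M. \<forall>j<3. X \<omega> \<inter> A m e j \<noteq> {}} \<in> events"
      using all_occupied_event[OF Ap Ad[OF e]] by blast
    have "prob {\<omega> \<in> space M. \<forall>j<3. X \<omega> \<inter> A m e j \<noteq> {}} \<le> (\<Prod>j<3. measure lborel (A m e j))"
      using prob_all_occupied_le[OF Ap Ad[OF e]] by blast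
    also have "\<dots> = h m * h m * measure lborel (D m e)"
      using h[of m] by (simp add: A_def cell_props numeral_3_eq_3)
    also have "measure lborel (D m e) \<le> h m"
    proof -
      have "measure lborel (D m e) \<le> measure lborel (cell ((a + b) / 2 + (real (fst e) + real (snd e)) * h m / 2) (h m) 0)"
        unfolding D_def using h[of m] B by (intro measure_mono_fmeasurable) (auto simp: cell_props cell_def fmeasurable_def)
      then show ?thesis using h[of m] by (simp add: cell_props)
    qed
    finally show "prob {\<omega> \<in> space M. \<forall>j<3. X \<omega> \<inter> A m e j \<noteq> {}} \<le> h m * h m * h m"
      using h[of m] by simp
  next
    fix m show "real (card ({..<2 ^ m :: nat} \<times> {..<2 ^ m :: nat})) * (h m * h m * h m) \<le> l ^ 3 * (1/2) ^ m"
      by (simp add: h_def power3_eq_cube power_divide)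
  next
    fix m \<omega> assume "\<exists>y\<in>X \<omega> \<inter> {a..<a + l}. \<exists>z\<in>X \<omega> \<inter> {b..<b + l}. (y + z) / 2 \<in> X \<omega> \<inter> B" "\<omega> \<in> space M"
    then obtain y z where yz: "y \<in> X \<omega>" "a \<le> y" "y < a + l" "z \<in> X \<omega>" "b \<le> z" "z < b + l"
      "(y + z) / 2 \<in> X \<omega>" "(y + z) / 2 \<in> B" by auto
    obtain i where i: "i < 2 ^ m" "y \<in> cell a (h m) i"
      using cell_cover[OF l yz(2,3)] unfolding h_def by blast
    obtain j where j: "j < 2 ^ m" "z \<in> cell b (h m) j"
      using cell_cover[OF l yz(5,6)] unfolding h_def by blast
    have "(y + z) / 2 \<in> D m (i, j)" using i(2) j(2) yz(8) by (auto simp: D_def cell_def field_simps)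
    then have "X \<omega> \<inter> A m (i, j) k \<noteq> {}" for k using i j yz by (auto simp: A_def)
    then show "\<exists>e\<in>{..<2 ^ m} \<times> {..<2 ^ m}. \<omega> \<in> {\<omega> \<in> space M. \<forall>j<3. X \<omega> \<inter> A m e j \<noteq> {}}"
      using i(1) j(1) \<open>\<omega> \<in> space M\<close> by (intro bexI[of _ "(i, j)"]) auto
  qed auto
qed

end

lemma floor_separates:
  fixes l x y :: real
  assumes "l > 0" "l \<le> \<bar>x - y\<bar>"
  shows "\<lfloor>x / l\<rfloor> \<noteq> \<lfloor>y / l\<rfloor>"
proof
  assume eq: "\<lfloor>x / l\<rfloor> = \<lfloor>y / l\<rfloor>"
  have "\<bar>x / l - y / l\<bar> < 1" using floor_correct[of "x / l"] floor_correct[of "y / l"] eq by linarith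
  also have "x / l - y / l = (x - y) / l" by (simp add: diff_divide_distrib)
  finally have "\<bar>x - y\<bar> / l < 1" using assms(1) by (simp add: abs_divide)
  then show False using assms by (simp add: field_simps)
qed

text \<open>
  There are countably many of these boxes, and any two distinct points lie in different boxes once \<open>n\<close> is
  large. This reduces statements about the whole line to disjoint bounded sets.
\<close>

definition box :: "nat \<Rightarrow> int \<Rightarrow> real set" where
  "box n i = {of_int i * (1 / Suc n)..<of_int i * (1 / Suc n) + 1 / Suc n}"

lemma mem_box_iff: "x \<in> box n i \<longleftrightarrow> \<lfloor>x / (1 / Suc n)\<rfloor> = i"
  by (auto simp: box_def floor_eq_iff field_simps)

lemma box_disjoint: "i \<noteq> j \<Longrightarrow> box n i \<inter> box n j = {}"
  using mem_box_iff by auto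

lemma boxes_separate:
  assumes "x \<noteq> (y::real)"
  shows "eventually (\<lambda>n. \<lfloor>x / (1 / Suc n)\<rfloor> \<noteq> \<lfloor>y / (1 / Suc n)\<rfloor>) sequentially"
proof -
  have "eventually (\<lambda>n. inverse (real (Suc n)) < \<bar>x - y\<bar>) sequentially"
    using assms by (intro order_tendstoD(2)[OF LIMSEQ_inverse_real_of_nat]) simp
  then show ?thesis
    by eventually_elim (intro floor_separates, auto simp: inverse_eq_divide)
qed

context unit_poisson_line
begin

lemma AE_no_reflected_pair: "AE \<omega> in M. \<forall>x\<in>X \<omega>. \<forall>y\<in>X \<omega>. x \<noteq> y \<longrightarrow> y \<noteq> 2 * x - c"
proof -
  have "AE \<omega> in M. \<forall>n i j. i \<noteq> j \<longrightarrow> \<not> (\<exists>x\<in>X \<omega> \<inter> box n i. \<exists>y\<in>X \<omega> \<inter> box n j. y = 2 * x - c)"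
  proof (unfold AE_all_countable, intro allI)
    fix n and i j :: int
    show "AE \<omega> in M. i \<noteq> j \<longrightarrow> \<not> (\<exists>x\<in>X \<omega> \<inter> box n i. \<exists>y\<in>X \<omega> \<inter> box n j. y = 2 * x - c)"
    proof (cases "i = j")
      case False
      then have "AE \<omega> in M. \<not> (\<exists>x\<in>X \<omega> \<inter> box n i. \<exists>y\<in>X \<omega> \<inter> box n j. y = 2 * x - c)"
        using box_disjoint[OF False, of n] unfolding box_def
        by (intro AE_no_reflected_pair_in) auto
      then show ?thesis by eventually_elim simp
    qed simp
  qed
  then show ?thesis
  proof eventually_elim
    case (elim \<omega>)
    show ?case
    proof (intro ballI impI)
      fix x y assume xy: "x \<in> X \<omega>" "y \<in> X \<omega>" "x \<noteq> y"
      obtain n where "\<lfloor>x / (1 / Suc n)\<rfloor> \<noteq> \<lfloor>y / (1 / Suc n)\<rfloor>"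
        using boxes_separate[OF xy(3)] by (auto simp: eventually_sequentially)
      then show "y \<noteq> 2 * x - c" using elim xy(1,2) mem_box_iff by blast
    qed
  qed
qed

lemma AE_no_midpoint:
  "AE \<omega> in M. \<forall>x\<in>X \<omega>. \<forall>y\<in>X \<omega>. \<forall>z\<in>X \<omega>. x \<noteq> y \<longrightarrow> x \<noteq> z \<longrightarrow> y \<noteq> z \<longrightarrow> (y + z) / 2 \<noteq> x"
proof -
  have "AE \<omega> in M. \<forall>n i j k. i \<noteq> j \<and> i \<noteq> k \<and> j \<noteq> k \<longrightarrow>
      \<not> (\<exists>y\<in>X \<omega> \<inter> box n i. \<exists>z\<in>X \<omega> \<inter> box n j. (y + z) / 2 \<in> X \<omega> \<inter> box n k)"
  proof (unfold AE_all_countable, intro allI)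
    fix n and i j k :: int
    show "AE \<omega> in M. i \<noteq> j \<and> i \<noteq> k \<and> j \<noteq> k \<longrightarrow>
      \<not> (\<exists>y\<in>X \<omega> \<inter> box n i. \<exists>z\<in>X \<omega> \<inter> box n j. (y + z) / 2 \<in> X \<omega> \<inter> box n k)"
    proof (cases "i \<noteq> j \<and> i \<noteq> k \<and> j \<noteq> k")
      case True
      then have "AE \<omega> in M. \<not> (\<exists>y\<in>X \<omega> \<inter> box n i. \<exists>z\<in>X \<omega> \<inter> box n j. (y + z) / 2 \<in> X \<omega> \<inter> box n k)"
        using box_disjoint[of i j n] box_disjoint[of i k n] box_disjoint[of j k n] unfolding box_def
        by (intro AE_no_midpoint_in) auto
      then show ?thesis by eventually_elim simp
    qed auto
  qed
  then show ?thesis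
  proof eventually_elim
    case (elim \<omega>)
    show ?case
    proof (intro ballI impI)
      fix x y z assume xyz: "x \<in> X \<omega>" "y \<in> X \<omega>" "z \<in> X \<omega>" "x \<noteq> y" "x \<noteq> z" "y \<noteq> z"
      have "eventually (\<lambda>n. \<lfloor>y / (1 / Suc n)\<rfloor> \<noteq> \<lfloor>z / (1 / Suc n)\<rfloor> \<and> \<lfloor>y / (1 / Suc n)\<rfloor> \<noteq> \<lfloor>x / (1 / Suc n)\<rfloor> \<and>
          \<lfloor>z / (1 / Suc n)\<rfloor> \<noteq> \<lfloor>x / (1 / Suc n)\<rfloor>) sequentially"
        using xyz by (intro eventually_conj boxes_separate) auto
      then obtain n where n: "\<lfloor>y / (1 / Suc n)\<rfloor> \<noteq> \<lfloor>z / (1 / Suc n)\<rfloor> \<and> \<lfloor>y / (1 / Suc n)\<rfloor> \<noteq> \<lfloor>x / (1 / Suc n)\<rfloor> \<and>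
          \<lfloor>z / (1 / Suc n)\<rfloor> \<noteq> \<lfloor>x / (1 / Suc n)\<rfloor>"
        by (auto simp: eventually_sequentially)
      have "y \<in> X \<omega> \<inter> box n \<lfloor>y / (1 / Suc n)\<rfloor>" "z \<in> X \<omega> \<inter> box n \<lfloor>z / (1 / Suc n)\<rfloor>"
        "x \<in> X \<omega> \<inter> box n \<lfloor>x / (1 / Suc n)\<rfloor>" using xyz mem_box_iff by auto
      then show "(y + z) / 2 \<noteq> x" using elim[rule_format, OF n] by blast
    qed
  qed
qed

text \<open>
  On the line, equal distances from \<open>x\<close> to two points make \<open>x\<close> their midpoint, and a point as far from \<open>x\<close> as the
  boundary is an endpoint of the interval or the reflection of one at \<open>x\<close>.
\<close>

lemma AE_no_ties: "AE \<omega> in M. no_ties {a..b} (X \<omega> \<inter> {a..b})"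
  using AE_no_midpoint AE_no_reflected_pair[of a] AE_no_reflected_pair[of b] AE_no_point[of a] AE_no_point[of b]
proof eventually_elim
  case (elim \<omega>)
  show ?case
    unfolding no_ties_def
  proof (intro ballI inj_onI)
    fix x t u
    assume x: "x \<in> X \<omega> \<inter> {a..b}"
      and t: "t \<in> insert None (Some ` (X \<omega> \<inter> {a..b} - {x}))"
      and u: "u \<in> insert None (Some ` (X \<omega> \<inter> {a..b} - {x}))"
      and eq: "core_dist {a..b} x t = core_dist {a..b} x u"
    have bd: "infdist x (- {a..b}) = min (x - a) (b - x)" using x by (intro infdist_interval) auto
    have no: "\<bar>x - y\<bar> \<noteq> min (x - a) (b - x)" if y: "y \<in> X \<omega>" "y \<noteq> x" for y
    proof
      assume "\<bar>x - y\<bar> = min (x - a) (b - x)"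
      then have "y = a \<or> y = b \<or> y = 2 * x - a \<or> y = 2 * x - b" by (auto simp: min_def abs_if split: if_splits)
      then show False using elim(2-5) x y by auto
    qed
    have no': "\<bar>x - y\<bar> \<noteq> \<bar>x - z\<bar>" if yz: "y \<in> X \<omega>" "z \<in> X \<omega>" "y \<noteq> x" "z \<noteq> x" "y \<noteq> z" for y z
    proof
      assume "\<bar>x - y\<bar> = \<bar>x - z\<bar>"
      then have "(y + z) / 2 = x" using yz by (auto simp: abs_if split: if_splits)
      then show False using elim(1)[rule_format, of x y z] x yz by auto
    qed
    show "t = u"
      using t u eq no no' by (auto simp: bd dist_real_def) metis+
  qed
qed

section \<open>Bad intervals as events\<close>

text \<open>
  The weight does not mention the position of the grid: this is where translation invariance comes from.
\<close>

definition pattern_weight :: "real \<Rightarrow> nat \<Rightarrow> nat set \<Rightarrow> real" where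
  "pattern_weight l m S = (\<Prod>i<2 ^ m. if i \<in> S then 1 - exp (- (l / 2 ^ m)) else exp (- (l / 2 ^ m)))"

lemma prob_occupied_cells:
  assumes l: "l > 0" and S: "S \<subseteq> {..<2 ^ m}"
  shows "{\<omega> \<in> space M. occupied_cells (X \<omega>) a l m = S} \<in> events"
    and "prob {\<omega> \<in> space M. occupied_cells (X \<omega>) a l m = S} = pattern_weight l m S"
proof -
  let ?h = "l / 2 ^ m"
  have h: "?h > 0" using l by simp
  have A: "\<And>i. i < 2 ^ m \<Longrightarrow> bounded (cell a ?h i) \<and> cell a ?h i \<in> sets borel"
    "disjoint_family_on (cell a ?h) {..<2 ^ m}"
    using cell_props cell_disjoint[OF h] by (auto simp: disjoint_family_on_def)
  have eq: "{\<omega> \<in> space M. occupied_cells (X \<omega>) a l m = S} =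
      {\<omega> \<in> space M. \<forall>i<2 ^ m. X \<omega> \<inter> cell a ?h i \<noteq> {} \<longleftrightarrow> i \<in> S}"
    using S unfolding occupied_cells_def by blast
  show "{\<omega> \<in> space M. occupied_cells (X \<omega>) a l m = S} \<in> events"
    unfolding eq by (rule prob_occupation_pattern(1)[OF A])
  show "prob {\<omega> \<in> space M. occupied_cells (X \<omega>) a l m = S} = pattern_weight l m S"
    unfolding eq pattern_weight_def
    by (rule trans[OF prob_occupation_pattern(2)[OF A]]) (simp_all only: cell_props(3)[OF h])
qed

lemma prod_lessThan_add: "(\<Prod>i<m + n. g i) = (\<Prod>i<m. g i) * (\<Prod>i<n. g (m + i :: nat) :: real)"
  by (induction n) (simp_all add: mult.assoc)

lemma prob_occupied_cells_pair:
  assumes l: "l > 0" and apart: "a + l \<le> a'" and S: "S \<subseteq> {..<2 ^ m}" "S' \<subseteq> {..<2 ^ m}"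
  shows "prob {\<omega> \<in> space M. occupied_cells (X \<omega>) a l m = S \<and> occupied_cells (X \<omega>) a' l m = S'} =
    pattern_weight l m S * pattern_weight l m S'"
proof -
  let ?h = "l / 2 ^ m" and ?n = "2 ^ m :: nat"
  have h: "?h > 0" using l by simp
  define A where "A i = (if i < ?n then cell a ?h i else cell a' ?h (i - ?n))" for i
  define T where "T = S \<union> (+) ?n ` S'"
  have A1: "bounded (A i) \<and> A i \<in> sets borel" for i using cell_props by (simp add: A_def)
  have sub: "cell a ?h i \<subseteq> {a..<a + l}" "cell a' ?h i \<subseteq> {a'..<a' + l}" if "i < ?n" for i
    using cell_subset[OF l that] by auto
  have "A i \<inter> A j = {}" if ij: "i < ?n + ?n" "j < ?n + ?n" "i \<noteq> j" for i j
  proof (cases "i < ?n \<longleftrightarrow> j < ?n")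
    case True
    then have "i < ?n \<and> j < ?n \<or> \<not> i < ?n \<and> \<not> j < ?n \<and> i - ?n \<noteq> j - ?n" using ij by linarith
    then show ?thesis using ij(3) cell_disjoint[OF h] unfolding A_def by (elim disjE conjE) simp_all
  next
    case False
    have meet: "cell a ?h i \<inter> cell a' ?h j = {}" if "i < ?n" "j < ?n" for i j
      using sub(1)[OF that(1)] sub(2)[OF that(2)] apart by force
    have "\<not> k < ?n \<Longrightarrow> k < ?n + ?n \<Longrightarrow> k - ?n < ?n" for k by linarith
    from False this show ?thesis
      using ij meet[of i "j - ?n"] meet[of j "i - ?n"] by (auto simp: A_def)
  qed
  then have A2: "disjoint_family_on A {..<?n + ?n}" by (auto simp: disjoint_family_on_def)
  have T: "i < ?n \<Longrightarrow> i \<in> T \<longleftrightarrow> i \<in> S" "?n + i \<in> T \<longleftrightarrow> i \<in> S'" for i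
    using S by (auto simp: T_def)
  have all_split: "(\<forall>i<?n + ?n. P i) \<longleftrightarrow> (\<forall>i<?n. P i) \<and> (\<forall>i<?n. P (?n + i))" for P
  proof (intro iffI conjI allI impI)
    fix i assume P: "(\<forall>i<?n. P i) \<and> (\<forall>i<?n. P (?n + i))" and i: "i < ?n + ?n"
    show "P i"
    proof (cases "i < ?n")
      case False
      then have "i = ?n + (i - ?n)" "i - ?n < ?n" using i by auto
      then show ?thesis using P by metis
    qed (use P in blast)
  qed auto
  have "{\<omega> \<in> space M. occupied_cells (X \<omega>) a l m = S \<and> occupied_cells (X \<omega>) a' l m = S'} =
      {\<omega> \<in> space M. (\<forall>i<?n. X \<omega> \<inter> cell a ?h i \<noteq> {} \<longleftrightarrow> i \<in> S) \<and> (\<forall>i<?n. X \<omega> \<inter> cell a' ?h i \<noteq> {} \<longleftrightarrow> i \<in> S')}"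
    using S unfolding occupied_cells_def by blast
  also have "\<dots> = {\<omega> \<in> space M. \<forall>i<?n + ?n. X \<omega> \<inter> A i \<noteq> {} \<longleftrightarrow> i \<in> T}"
    unfolding all_split using T by (simp add: A_def)
  finally have "prob {\<omega> \<in> space M. occupied_cells (X \<omega>) a l m = S \<and> occupied_cells (X \<omega>) a' l m = S'} =
      (\<Prod>i<?n + ?n. if i \<in> T then 1 - exp (- measure lborel (A i)) else exp (- measure lborel (A i)))"
    by (simp only: prob_occupation_pattern(2)[OF A1 A2])
  also have "\<dots> = (\<Prod>i<?n + ?n. if i \<in> T then 1 - exp (- ?h) else exp (- ?h))"
    by (intro prod.cong refl) (simp add: A_def cell_props(3)[OF h])
  also have "\<dots> = pattern_weight l m S * pattern_weight l m S'"
    unfolding prod_lessThan_add pattern_weight_def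
    by (intro arg_cong2[where f = "(*)"] prod.cong refl) (simp_all add: T)
  finally show ?thesis .
qed

definition grid_bad :: "real \<Rightarrow> real \<Rightarrow> nat \<Rightarrow> 'w set" where
  "grid_bad a l m = {\<omega> \<in> space M. \<not> good_interval (grid_points a l m (occupied_cells (X \<omega>) a l m)) a (a + l)}"

text \<open>
  Translating the grid to the origin makes this set independent of the position of the interval.
\<close>

definition bad_patterns :: "real \<Rightarrow> nat \<Rightarrow> nat set set" where
  "bad_patterns l m = {S \<in> Pow {..<2 ^ m}. \<not> good_interval (grid_points 0 l m S) 0 l}"

lemma grid_bad_eq: "grid_bad a l m = (\<Union>S\<in>bad_patterns l m. {\<omega> \<in> space M. occupied_cells (X \<omega>) a l m = S})"
proof -
  have "grid_points a l m T = (\<lambda>x. x + a) ` grid_points 0 l m T" for T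
    by (auto simp: grid_points_def image_image add.commute)
  then have "good_interval (grid_points a l m T) a (a + l) \<longleftrightarrow> good_interval (grid_points 0 l m T) 0 l" for T
    using good_interval_translate[where c = a and a = 0 and b = l] by (simp add: add.commute)
  then show ?thesis by (auto simp: grid_bad_def bad_patterns_def occupied_cells_def)
qed

lemma finite_bad_patterns: "finite (bad_patterns l m)" by (simp add: bad_patterns_def)

lemma grid_bad_event: "l > 0 \<Longrightarrow> grid_bad a l m \<in> events"
  unfolding grid_bad_eq
  by (intro sets.finite_UN finite_bad_patterns prob_occupied_cells(1)) (auto simp: bad_patterns_def)

lemma prob_grid_bad:
  assumes l: "l > 0"
  shows "prob (grid_bad a l m) = (\<Sum>S\<in>bad_patterns l m. pattern_weight l m S)"
proof -
  have "prob (grid_bad a l m) = (\<Sum>S\<in>bad_patterns l m. prob {\<omega> \<in> space M. occupied_cells (X \<omega>) a l m = S})"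
    unfolding grid_bad_eq
    by (intro finite_measure_finite_Union finite_bad_patterns)
      (auto simp: disjoint_family_on_def bad_patterns_def intro!: prob_occupied_cells(1)[OF l])
  also have "\<dots> = (\<Sum>S\<in>bad_patterns l m. pattern_weight l m S)"
    by (intro sum.cong refl prob_occupied_cells(2)[OF l]) (auto simp: bad_patterns_def)
  finally show ?thesis .
qed

lemma prob_grid_bad_pair:
  assumes l: "l > 0" and apart: "a + l \<le> a'"
  shows "prob (grid_bad a l m \<inter> grid_bad a' l m) = (prob (grid_bad 0 l m))\<^sup>2"
proof -
  let ?B = "bad_patterns l m"
  let ?F = "\<lambda>(S, S'). {\<omega> \<in> space M. occupied_cells (X \<omega>) a l m = S \<and> occupied_cells (X \<omega>) a' l m = S'}"
  have sub: "S \<subseteq> {..<2 ^ m}" if "S \<in> ?B" for S using that by (auto simp: bad_patterns_def)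
  have ev: "?F e \<in> events" if "e \<in> ?B \<times> ?B" for e
  proof -
    have "?F e = {\<omega> \<in> space M. occupied_cells (X \<omega>) a l m = fst e} \<inter> {\<omega> \<in> space M. occupied_cells (X \<omega>) a' l m = snd e}"
      by (auto split: prod.splits)
    then show ?thesis
      using that prob_occupied_cells(1)[OF l sub] by (auto intro!: sets.Int simp: mem_Times_iff)
  qed
  have "grid_bad a l m \<inter> grid_bad a' l m = (\<Union>e\<in>?B \<times> ?B. ?F e)"
    unfolding grid_bad_eq by auto
  then have "prob (grid_bad a l m \<inter> grid_bad a' l m) = (\<Sum>e\<in>?B \<times> ?B. prob (?F e))"
    using ev finite_bad_patterns
    by (simp only:) (intro finite_measure_finite_Union, auto simp: disjoint_family_on_def)
  also have "\<dots> = (\<Sum>(S, S')\<in>?B \<times> ?B. pattern_weight l m S * pattern_weight l m S')"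
    using prob_occupied_cells_pair[OF l apart sub sub] by (intro sum.cong refl) auto
  also have "\<dots> = (\<Sum>S\<in>?B. pattern_weight l m S) * (\<Sum>S\<in>?B. pattern_weight l m S)"
    by (simp add: sum_product sum.cartesian_product)
  finally show ?thesis by (simp add: prob_grid_bad[OF l] power2_eq_square)
qed

text \<open>
  An event that almost surely agrees with badness of \<open>{a..a + l}\<close>; the set of all outcomes for which the interval
  is bad is not known to be an event.
\<close>

definition bad_event :: "real \<Rightarrow> real \<Rightarrow> 'w set" where
  "bad_event a l = {\<omega> \<in> space M. eventually (\<lambda>m. \<omega> \<in> grid_bad a l m) sequentially}"

lemma bad_event_event: "l > 0 \<Longrightarrow> bad_event a l \<in> events"
proof -
  assume "l > 0"
  then have "(\<Union>N. \<Inter>m\<in>{N..}. grid_bad a l m) \<in> events"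
    by (intro sets.countable_UN' sets.countable_INT' grid_bad_event) (auto intro: grid_bad_event)
  moreover have "bad_event a l = (\<Union>N. \<Inter>m\<in>{N..}. grid_bad a l m)"
    by (auto simp: bad_event_def eventually_sequentially grid_bad_def)
  ultimately show ?thesis by simp
qed

lemma AE_grid_bad:
  assumes l: "l > 0"
  shows "AE \<omega> in M. eventually (\<lambda>m. \<omega> \<in> grid_bad a l m \<longleftrightarrow> \<not> good_interval (X \<omega>) a (a + l)) sequentially"
  using AE_space AE_no_ties[of a "a + l"] AE_no_point[of "a + l"]
proof eventually_elim
  case (elim \<omega>)
  have "eventually (\<lambda>m. good_interval (grid_points a l m (occupied_cells (X \<omega>) a l m)) a (a + l) \<longleftrightarrow>
           good_interval (X \<omega>) a (a + l)) sequentially"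
    by (rule good_interval_grid_approximation[OF finite_points[OF elim(1)] elim(2) l elim(3)])
  then show ?case by eventually_elim (use elim(1) in \<open>simp add: grid_bad_def\<close>)
qed

lemma AE_bad_event:
  assumes l: "l > 0"
  shows "AE \<omega> in M. \<omega> \<in> bad_event a l \<longleftrightarrow> \<not> good_interval (X \<omega>) a (a + l)"
  using AE_space AE_grid_bad[OF l, of a]
proof eventually_elim
  case (elim \<omega>)
  show ?case
  proof (cases "good_interval (X \<omega>) a (a + l)")
    case True
    then have "eventually (\<lambda>m. \<omega> \<notin> grid_bad a l m) sequentially" using elim(2) by simp
    then have "\<omega> \<notin> bad_event a l"
      unfolding bad_event_def by (auto simp: eventually_sequentially) (metis nat_le_linear)
    then show ?thesis using True by simp
  qed (use elim in \<open>simp add: bad_event_def\<close>)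
qed

lemma prob_tendsto:
  assumes A: "\<And>m. A m \<in> events" and B: "B \<in> events"
    and AE: "AE \<omega> in M. eventually (\<lambda>m. \<omega> \<in> A m \<longleftrightarrow> \<omega> \<in> B) sequentially"
  shows "(\<lambda>m. prob (A m)) \<longlonglongrightarrow> prob B"
proof -
  have "(\<lambda>m. integral\<^sup>L M (indicator (A m) :: _ \<Rightarrow> real)) \<longlonglongrightarrow> integral\<^sup>L M (indicator B :: _ \<Rightarrow> real)"
  proof (rule integral_dominated_convergence[where w = "\<lambda>_. 1"])
    show "AE \<omega> in M. (\<lambda>m. indicator (A m) \<omega> :: real) \<longlonglongrightarrow> indicator B \<omega>"
      using AE
    proof eventually_elim
      case (elim \<omega>)
      then show ?case
        by (intro tendsto_eventually) (auto elim!: eventually_mono simp: indicator_def)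
    qed
  qed (use A B in \<open>auto simp: indicator_def\<close>)
  then show ?thesis using A B sets.sets_into_space by (simp add: Int_absorb2)
qed

lemma grid_bad_tendsto:
  assumes l: "l > 0"
  shows "(\<lambda>m. prob (grid_bad a l m)) \<longlonglongrightarrow> prob (bad_event a l)"
proof (rule prob_tendsto)
  show "AE \<omega> in M. eventually (\<lambda>m. \<omega> \<in> grid_bad a l m \<longleftrightarrow> \<omega> \<in> bad_event a l) sequentially"
    using AE_grid_bad[OF l, of a] AE_bad_event[OF l, of a]
  proof eventually_elim
    case (elim \<omega>)
    then show ?case by simp
  qed
qed (auto intro: grid_bad_event bad_event_event l)

lemma prob_bad_event: "l > 0 \<Longrightarrow> prob (bad_event a l) = prob (bad_event 0 l)"
  using grid_bad_tendsto[of l a] grid_bad_tendsto[of l 0] prob_grid_bad[of l]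
  by (simp add: LIMSEQ_unique)

text \<open>
  Half-open cells of intervals that share at most an endpoint are disjoint, which makes the
  approximating events independent.
\<close>

lemma prob_bad_event_pair:
  assumes l: "l > 0" and apart: "a + l \<le> a'"
  shows "prob (bad_event a l \<inter> bad_event a' l) = (prob (bad_event 0 l))\<^sup>2"
proof (rule LIMSEQ_unique)
  show "(\<lambda>m. prob (grid_bad a l m \<inter> grid_bad a' l m)) \<longlonglongrightarrow> prob (bad_event a l \<inter> bad_event a' l)"
  proof (rule prob_tendsto)
    show "AE \<omega> in M. eventually (\<lambda>m. \<omega> \<in> grid_bad a l m \<inter> grid_bad a' l m \<longleftrightarrow> \<omega> \<in> bad_event a l \<inter> bad_event a' l) sequentially"
      using AE_grid_bad[OF l, of a] AE_bad_event[OF l, of a] AE_grid_bad[OF l, of a'] AE_bad_event[OF l, of a']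
    proof eventually_elim
      case (elim \<omega>)
      show ?case using elim(1,3) by eventually_elim (use elim(2,4) in auto)
    qed
  qed (auto intro: grid_bad_event bad_event_event l)
  show "(\<lambda>m. prob (grid_bad a l m \<inter> grid_bad a' l m)) \<longlonglongrightarrow> (prob (bad_event 0 l))\<^sup>2"
    unfolding prob_grid_bad_pair[OF assms] by (intro tendsto_power grid_bad_tendsto l)
qed

section \<open>Bad intervals at growing scales\<close>

text \<open>
  The union bound over the \<open>11\<close> pairs of intervals at index distance two, each of which is independent.
\<close>

lemma bad_probability_renormalise:
  assumes l: "l > 0"
  shows "prob (bad_event 0 (7 * l)) \<le> 11 * (prob (bad_event 0 l))\<^sup>2"
proof -
  let ?F = "\<lambda>k::nat. bad_event (real k * l / 2) l \<inter> bad_event (real (k + 2) * l / 2) l"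
  have F: "?F k \<in> events" for k using l by (intro sets.Int bad_event_event)
  have AE_all: "AE \<omega> in M. \<forall>k::nat. \<omega> \<in> bad_event (real k * l / 2) l \<longleftrightarrow>
      \<not> good_interval (X \<omega>) (real k * l / 2) (real k * l / 2 + l)"
    unfolding AE_all_countable using AE_bad_event[OF l] by blast
  have "AE \<omega> in M. \<omega> \<in> bad_event 0 (7 * l) \<longrightarrow> \<omega> \<in> (\<Union>k\<in>{..10}. ?F k)"
    using AE_space AE_all AE_bad_event[of "7 * l" 0, simplified, OF l] AE_no_ties[of 0 "0 + 7 * l"]
  proof eventually_elim
    case (elim \<omega>)
    show ?case
    proof (rule impI, rule ccontr)
      assume bad: "\<omega> \<in> bad_event 0 (7 * l)" "\<omega> \<notin> (\<Union>k\<in>{..10}. ?F k)"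
      have "good_interval (X \<omega>) 0 (0 + 7 * l)"
      proof (rule good_interval_renormalise[OF finite_points[OF elim(1)] elim(4) l])
        fix k :: nat assume "k \<le> 10"
        then have "\<omega> \<notin> ?F k" using bad(2) by blast
        then show "good_interval (X \<omega>) (0 + real k * l / 2) (0 + real k * l / 2 + l) \<or>
            good_interval (X \<omega>) (0 + real (k + 2) * l / 2) (0 + real (k + 2) * l / 2 + l)"
          using elim(2)[rule_format, of k] elim(2)[rule_format, of "k + 2"] unfolding add_0_left by blast
      qed
      then show False using elim(3) bad(1) by simp
    qed
  qed
  then have "prob (bad_event 0 (7 * l)) \<le> prob (\<Union>k\<in>{..10}. ?F k)"
    using F by (intro finite_measure_mono_AE) auto
  also have "\<dots> \<le> (\<Sum>k\<in>{..10}. prob (?F k))"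
    using F by (intro finite_measure_subadditive_finite) auto
  also have "\<dots> = (\<Sum>k\<in>{..10::nat}. (prob (bad_event 0 l))\<^sup>2)"
    by (intro sum.cong refl prob_bad_event_pair[OF l]) (simp add: field_simps)
  finally show ?thesis by simp
qed

lemma bad_probability_decays:
  assumes l: "l > 0" and start: "11 * prob (bad_event 0 l) \<le> r" and r: "r \<le> 1"
  shows "11 * prob (bad_event 0 (7 ^ n * l)) \<le> r ^ Suc n"
proof (induction n)
  case (Suc n)
  let ?q = "prob (bad_event 0 (7 ^ n * l))"
  have "0 \<le> r" using start measure_nonneg[of M "bad_event 0 l"] by linarith
  have "11 * prob (bad_event 0 (7 ^ Suc n * l)) \<le> (11 * ?q)\<^sup>2"
    using bad_probability_renormalise[of "7 ^ n * l"] l by (simp add: power2_eq_square mult.assoc)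
  also have "\<dots> \<le> (r ^ Suc n)\<^sup>2" using Suc by (intro power_mono) auto
  also have "\<dots> = r ^ (2 * Suc n)" by (simp only: mult.commute[of 2] power_mult)
  also have "\<dots> \<le> r ^ Suc (Suc n)" using \<open>0 \<le> r\<close> r by (intro power_decreasing) auto
  finally show ?case .
qed (use start in simp)

text \<open>
  Ten intervals are required to be good at each scale: nine to continue the component, and one around the
  origin for the existence and uniqueness of the stable multi-matching.
\<close>

lemma AE_good_scales:
  assumes L: "L > 0" and good: "prob {\<omega> \<in> space M. good_interval (X \<omega>) 0 L} > 0.968"
  shows "AE \<omega> in M. eventually (\<lambda>n. good_interval (X \<omega>) (- (7 ^ n * L) / 2) (7 ^ n * L / 2) \<and>
      (\<forall>k\<in>{1..9::nat}. good_interval (X \<omega>) (real k * (7 ^ n * L) / 2) (real k * (7 ^ n * L) / 2 + 7 ^ n * L)))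
      sequentially"
proof -
  define l where "l n = 7 ^ n * L" for n :: nat
  have l: "l n > 0" for n using L by (simp add: l_def)
  let ?G = "{\<omega> \<in> space M. good_interval (X \<omega>) 0 L}"
  \<comment> \<open>a set that is not an event has measure \<open>0\<close>\<close>
  have G: "?G \<in> events" by (rule ccontr) (use good measure_notin_sets[of ?G M] in simp)
  have "prob (bad_event 0 L) = prob (space M - ?G)"
  proof (rule finite_measure_eq_AE)
    show "AE \<omega> in M. \<omega> \<in> bad_event 0 L \<longleftrightarrow> \<omega> \<in> space M - ?G"
      using AE_space AE_bad_event[OF L, of 0] by eventually_elim auto
  qed (use G L bad_event_event in auto)
  then have "prob (bad_event 0 L) < 0.032" using good prob_compl[OF G] by simp
  \<comment> \<open>\<open>0.352 = 11 * 0.032\<close>\<close>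
  then have q: "11 * prob (bad_event 0 (l n)) \<le> 0.352 ^ Suc n" for n
    unfolding l_def by (intro bad_probability_decays[OF L]) auto
  \<comment> \<open>the interval with index \<open>0\<close> is centred at the origin\<close>
  define start where "start n j = (if j = 0 then - l n / 2 else real j * l n / 2)" for n j
  define B where "B n = (\<Union>j\<in>{..9::nat}. bad_event (start n j) (l n))" for n
  have B: "B n \<in> events" for n unfolding B_def using l bad_event_event by (intro sets.finite_UN) auto
  have le: "prob (B n) \<le> 0.352 ^ n" for n
  proof -
    have "prob (B n) \<le> (\<Sum>j\<in>{..9::nat}. prob (bad_event (start n j) (l n)))"
      unfolding B_def using l bad_event_event by (intro finite_measure_subadditive_finite) auto
    also have "\<dots> = (\<Sum>j\<in>{..9::nat}. prob (bad_event 0 (l n)))"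
      by (intro sum.cong refl prob_bad_event l)
    also have "\<dots> = 10 * prob (bad_event 0 (l n))" by simp
    also have "\<dots> \<le> 11 * prob (bad_event 0 (l n))" by (intro mult_right_mono) auto
    also have "\<dots> \<le> 0.352 ^ Suc n" by (rule q)
    also have "\<dots> \<le> 0.352 ^ n" by (rule power_decreasing) auto
    finally show ?thesis .
  qed
  have "summable (\<lambda>n. 0.352 ^ n :: real)" by (rule summable_geometric) simp
  then have "summable (\<lambda>n. prob (B n))"
    by (rule summable_comparison_test'[where N = 0])
      (simp only: real_norm_def abs_of_nonneg[OF measure_nonneg] le)
  then have "AE \<omega> in M. eventually (\<lambda>n. \<omega> \<in> space M - B n) sequentially"
    using B by (intro borel_cantelli_AE1) (auto simp: emeasure_eq_measure)
  moreover have "AE \<omega> in M. \<forall>n j. \<omega> \<in> bad_event (start n j) (l n) \<longleftrightarrow>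
      \<not> good_interval (X \<omega>) (start n j) (start n j + l n)"
    unfolding AE_all_countable using AE_bad_event[OF l] by blast
  ultimately show ?thesis
  proof eventually_elim
    case (elim \<omega>)
    show ?case
      using elim(1)
    proof eventually_elim
      case (elim n)
      then have g: "good_interval (X \<omega>) (start n j) (start n j + l n)" if "j \<le> 9" for j
        using \<open>\<forall>n j. _ n j\<close> that by (auto simp: B_def)
      show ?case
      proof (intro conjI ballI)
        show "good_interval (X \<omega>) (- (7 ^ n * L) / 2) (7 ^ n * L / 2)"
          using g[of 0] by (simp add: start_def l_def mult.commute)
        show "good_interval (X \<omega>) (real k * (7 ^ n * L) / 2) (real k * (7 ^ n * L) / 2 + 7 ^ n * L)"
          if "k \<in> {1..9}" for k
          using g[of k] that by (simp add: start_def l_def)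
      qed
    qed
  qed
qed

end

theorem theorem4p2:
  fixes M :: "'w measure" and \<X> :: "'w \<Rightarrow> real set" and L :: real
  assumes "homogeneous_poisson_process M 1 \<X>"
    and "L > 0"
    and "\<P>(\<omega> in M. good_interval (\<X> \<omega>) 0 L) > 0.968"
  shows "AE \<omega> in M. \<exists>C \<in> graph_components (\<X> \<omega>) (stable_multi_matching (\<X> \<omega>)). infinite C"
proof -
  interpret unit_poisson_line M \<X> using assms(1) by (simp add: unit_poisson_line_def)
  define c where "c n = 7 ^ n * L / 2" for n :: nat
  have "AE \<omega> in M. \<forall>n. no_ties {- c n..c n} (\<X> \<omega> \<inter> {- c n..c n})"
    unfolding AE_all_countable using AE_no_ties by blast
  with AE_space AE_good_scales[OF assms(2,3)] show ?thesis
  proof eventually_elim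
    case (elim \<omega>)
    have "\<exists>!E. is_stable_multi_matching (\<X> \<omega>) E"
    proof (rule stable_multi_matching_exists_unique[where c = c])
      show "incseq c" using assms(2) by (auto simp: incseq_def c_def intro!: power_increasing)
      have "filterlim (\<lambda>n. 7 ^ n :: real) at_top sequentially"
        by (intro filterlim_at_infinity_imp_filterlim_at_top filterlim_realpow_sequentially_gt1) auto
      then have "filterlim (\<lambda>n. (L / 2) * 7 ^ n) at_top sequentially"
        using assms(2) by (intro filterlim_tendsto_pos_mult_at_top[OF tendsto_const]) auto
      then show "filterlim c at_top sequentially" by (simp add: c_def[abs_def] mult.commute)
      show "eventually (\<lambda>n. good_interval (\<X> \<omega>) (- c n) (c n)) sequentially"
        using elim(2) by eventually_elim (simp add: c_def)
    qed (use elim(1,3) finite_points in auto)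
    then have stable: "is_stable_multi_matching (\<X> \<omega>) (stable_multi_matching (\<X> \<omega>))"
      unfolding stable_multi_matching_def by (rule theI')
    obtain N where "\<forall>n\<ge>N. \<forall>k\<in>{1..9::nat}.
        good_interval (\<X> \<omega>) (real k * (7 ^ n * L) / 2) (real k * (7 ^ n * L) / 2 + 7 ^ n * L)"
      using elim(2) unfolding eventually_sequentially by blast
    then show ?case
      by (intro infinite_component_if_good_scales[OF stable assms(2), of N]) auto
  qed
qed

end
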